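(* Let $X$ and $Y$ be Banach spaces, and let $\{x_n\}$ and $\{y_n\}$ be normalized basic sequences of $X$ and $Y$, respectively. Suppose that the following two conditions hold: (1) for every subsequence $\{x_{b_n}\}$ of $\{x_n\}$, $\{x_{b_n}\}$ does not dominate $\{y_n\}$; and (2) $\{y_n\}$ is lower semi-homogeneous. Then $E(X,(x_n)) \nleq_B E(Y,(y_n))$.
   Context: Banach spaces are over $\mathbb{R}$; $\mathbb{N}=\{0,1,2,\ldots\}$. A basic sequence $\{x_n\}$ in a Banach space $X$ is a sequence (indexed by $\mathbb{N}$) that is a Schauder basis of its closed linear span; it is normalized if $\|x_n\|=1$ for all $n$. For a basic sequence $\{x_n\}$ in $X$, $\mathrm{coef}(X,(x_n))$ is the set of all $a=(a_n)\in\mathbb{R}^{\mathbb{N}}$ such that $\sum_n a_nx_n$ converges in $X$, and $E(X,(x_n))$ is the (Borel) equivalence relation on $\mathbb{R}^{\mathbb{N}}$ given by $(x,y)\in E(X,(x_n)) \iff x-y\in \mathrm{coef}(X,(x_n))$. A basic sequence $\{x_n\}$ in $X$ dominates a basic sequence $\{y_n\}$ in $Y$ if $\mathrm{coef}(X,(x_n))\subseteq\mathrm{coef}(Y,(y_n))$. A block basis of $\{x_n\}$ is a sequence of non-zero vectors $\{u_j\}$ of the form $u_j=\sum_{n=p_j+1}^{p_{j+1}}a_nx_n$ with $\{a_n\}$ scalars and $p_1<p_2<\cdots$ an increasing sequence of integers. A normalized basic sequence is lower semi-homogeneous if each of its normalized block bases dominates it. For equivalence relations $E,F$ on Polish spaces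 $P,Q$, $E\leq_B F$ means that there is a Borel function $\theta:P\to Q$ with $xEy\iff\theta(x)F\theta(y)$ for all $x,y\in P$; $\nleq_B$ is its negation. *)

theory Defs
  imports "HOL-Analysis.Analysis"
begin

definition schauder_basis :: "(nat \<Rightarrow> 'a::real_normed_vector) \<Rightarrow> 'a set \<Rightarrow> bool" where
  "schauder_basis x S \<longleftrightarrow>
     range x \<subseteq> S \<and> (\<forall>v\<in>S. \<exists>!a::nat \<Rightarrow> real. (\<lambda>n. a n *\<^sub>R x n) sums v)"

definition basic_sequence :: "(nat \<Rightarrow> 'a::banach) \<Rightarrow> bool" where
  "basic_sequence x \<longleftrightarrow> schauder_basis x (closure (span (range x)))"

definition normalized :: "(nat \<Rightarrow> 'a::real_normed_vector) \<Rightarrow> bool" where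
  "normalized x \<longleftrightarrow> (\<forall>n. norm (x n) = 1)"

definition coef :: "(nat \<Rightarrow> 'a::real_normed_vector) \<Rightarrow> (nat \<Rightarrow> real) set" where
  "coef x = {a. summable (\<lambda>n. a n *\<^sub>R x n)}"

definition coef_rel :: "(nat \<Rightarrow> 'a::real_normed_vector) \<Rightarrow> (nat \<Rightarrow> real) rel" where
  "coef_rel x = {(a, b). (\<lambda>n. a n - b n) \<in> coef x}"

lemma equiv_coef_rel: "equiv UNIV (coef_rel x)"
proof (rule equivI)
  show "refl (coef_rel x)"
    by (auto simp: refl_on_def coef_rel_def coef_def)
  show "sym (coef_rel x)"
  proof (rule symI)
    fix a b assume "(a, b) \<in> coef_rel x"
    then have "summable (\<lambda>n. - ((a n - b n) *\<^sub>R x n))"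
      by (auto simp: coef_rel_def coef_def intro: summable_minus)
    then show "(b, a) \<in> coef_rel x"
      by (simp add: coef_rel_def coef_def algebra_simps)
  qed
  show "trans (coef_rel x)"
  proof (rule transI)
    fix a b c assume "(a, b) \<in> coef_rel x" "(b, c) \<in> coef_rel x"
    then have "summable (\<lambda>n. (a n - b n) *\<^sub>R x n + (b n - c n) *\<^sub>R x n)"
      by (auto simp: coef_rel_def coef_def intro: summable_add)
    then show "(a, c) \<in> coef_rel x"
      by (simp add: coef_rel_def coef_def algebra_simps)
  qed
qed auto

definition dominates ::
  "(nat \<Rightarrow> 'a::real_normed_vector) \<Rightarrow> (nat \<Rightarrow> 'b::real_normed_vector) \<Rightarrow> bool" where
  "dominates x y \<longleftrightarrow> coef x \<subseteq> coef y"

text \<open>Since sequences start at index 0, the summation range from \<open>p\<^sub>j + 1\<close> to \<open>p\<^sub>j\<^sub>+\<^sub>1\<close> of the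
  textbook definition, with integers \<open>p\<^sub>j \<ge> -1\<close>, is written as a half-open interval: the \<open>p j\<close>
  below is the textbook \<open>p\<^sub>j + 1\<close>. In particular a block may use the vector \<open>x 0\<close>.\<close>

definition block_basis ::
  "(nat \<Rightarrow> 'a::real_normed_vector) \<Rightarrow> (nat \<Rightarrow> 'a) \<Rightarrow> bool" where
  "block_basis x u \<longleftrightarrow>
     (\<exists>(p::nat \<Rightarrow> nat) (a::nat \<Rightarrow> real). strict_mono p \<and>
        (\<forall>j. u j = (\<Sum>n\<in>{p j..<p (Suc j)}. a n *\<^sub>R x n) \<and> u j \<noteq> 0))"

definition lower_semi_homogeneous :: "(nat \<Rightarrow> 'a::real_normed_vector) \<Rightarrow> bool" where
  "lower_semi_homogeneous x \<longleftrightarrow>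
     (\<forall>u. block_basis x u \<and> normalized u \<longrightarrow> dominates u x)"

text \<open>Borel reducibility of equivalence relations on Polish spaces. The type \<open>nat \<Rightarrow> real\<close> is an
  instance of \<^class>\<open>polish_space\<close> with the product topology.\<close>

definition borel_reducible :: "'a::polish_space rel \<Rightarrow> 'b::polish_space rel \<Rightarrow> bool" where
  "borel_reducible E F \<longleftrightarrow>
     (\<exists>\<theta>\<in>borel_measurable borel. \<forall>x y. (x, y) \<in> E \<longleftrightarrow> (\<theta> x, \<theta> y) \<in> F)"

end

theory Submission
  imports Defs
begin

text \<open>A Borel reduction \<open>\<theta>\<close> is first thinned out to a reduction of product form, and then walked along in
short steps. Compose \<open>\<theta>\<close> with \<open>w \<mapsto> (w i / 2 ^ i)\<^sub>i\<close> to get a Borel map \<open>\<psi>\<close> on the Baire space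
\<open>nat \<Rightarrow> nat\<close>; it is continuous on a comeager set (\<open>borel_measurable_continuous_on_comeager\<close>). Points
that differ in finitely many coordinates have equivalent images, so the Baire category theorem
makes this equivalence uniform: after fixing a suitable finite string \<open>s\<close> of further coordinates,
changing the coordinates before \<open>s\<close> changes the image only slightly beyond some place \<open>l\<close>, and,
by continuity, changing those after \<open>s\<close> changes it only slightly before \<open>l\<close>
(\<open>stabilizing_string\<close>). Iterating this leaves free coordinates \<open>b 0 < b 1 < \<dots>\<close> with fixed strings
in between, and up to a summable error the image on the \<open>j\<close>-th block \<open>[p j, p (j + 1))\<close> depends on
the \<open>j\<close>-th free coordinate alone (\<open>fusion\<close>, \<open>borel_reducible_imp_product_reduction\<close>).

Let \<open>f j t\<close> be the image on the \<open>j\<close>-th block for the value \<open>t \<le> 2 ^ b j\<close>, which stands for the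
scalar \<open>t / 2 ^ b j\<close>. If there were values at distance at least \<open>1/2\<close> whose images are close
together on infinitely many blocks, then a sequence whose terms do not tend to \<open>0\<close> would be
equivalent to \<open>0\<close>; so all but finitely many blocks send such pairs at least \<open>\<delta>\<close> apart
(\<open>product_reduction_separates\<close>). Walking from \<open>0\<close> to \<open>1/2\<close> in steps of length \<open>\<eta>\<close> takes at most
\<open>1/\<eta>\<close> steps, so one of them moves the image by at least \<open>\<delta> \<eta>\<close> (\<open>exists_long_step\<close>).

Now choose \<open>a\<close> for which \<open>\<Sum> a j x (b j)\<close> converges and \<open>\<Sum> a j y j\<close> does not; this is possible since
the subsequence \<open>x \<circ> b\<close> does not dominate \<open>y\<close>. After rounding to the grid, \<open>a j\<close> is the difference of
two values of the \<open>j\<close>-th free coordinate that form a long step. The reduction turns these pairs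
into a convergent series in \<open>y\<close> whose \<open>j\<close>-th block contains an interval with sum of norm at least
\<open>\<delta> \<bar>a j\<bar>\<close>. Lower semi-homogeneity applied to the block bases \<open>(\<plusminus>y j)\<close> makes \<open>coef y\<close> solid
(\<open>coef_solid\<close>), so the series may be cut down to these intervals. As normalized block bases dominate
\<open>y\<close>, the norms of the blocks then belong to \<open>coef y\<close> themselves (\<open>block_norms_in_coef\<close>), and
solidity gives \<open>a \<in> coef y\<close>, a contradiction.\<close>

section \<open>Borel maps are continuous on a comeager set\<close>

definition comeager :: "'a::topological_space set \<Rightarrow> bool" where
  "comeager A \<longleftrightarrow>
     (\<exists>\<D>. countable \<D> \<and> (\<forall>D\<in>\<D>. open D \<and> closure D = UNIV) \<and> \<Inter>\<D> \<subseteq> A)"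

lemma comeager_dense_open: "open D \<Longrightarrow> closure D = UNIV \<Longrightarrow> comeager D"
  unfolding comeager_def by (intro exI[of _ "{D}"]) auto

lemma comeager_mono: "comeager A \<Longrightarrow> A \<subseteq> B \<Longrightarrow> comeager B"
  unfolding comeager_def by (meson order_trans)

lemma comeager_INT:
  assumes "countable I" "\<And>i. i \<in> I \<Longrightarrow> comeager (A i)"
  shows "comeager (\<Inter>i\<in>I. A i)"
proof -
  obtain \<D> where *: "\<And>i. i \<in> I \<Longrightarrow> countable (\<D> i) \<and>
      (\<forall>D\<in>\<D> i. open D \<and> closure D = UNIV) \<and> \<Inter>(\<D> i) \<subseteq> A i"
    using assms(2) unfolding comeager_def by metis
  have "countable (\<Union>i\<in>I. \<D> i)" using assms(1) * by blast
  moreover have "\<Inter>(\<Union>i\<in>I. \<D> i) \<subseteq> (\<Inter>i\<in>I. A i)" using * by fastforce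
  ultimately show ?thesis unfolding comeager_def using * by (metis UN_E)
qed

lemma comeager_Int: "comeager A \<Longrightarrow> comeager B \<Longrightarrow> comeager (A \<inter> B)"
  using comeager_INT[of "{True, False}" "\<lambda>b. if b then A else B"] by (simp add: Int_commute)

text \<open>The sets with the property of Baire.\<close>

definition almost_open :: "'a::topological_space set \<Rightarrow> bool" where
  "almost_open A \<longleftrightarrow> (\<exists>U. open U \<and> comeager {z. z \<in> A \<longleftrightarrow> z \<in> U})"

lemma comeager_complement_boundary:
  assumes "open U"
  shows "comeager (U \<union> - closure U)"
proof (rule comeager_dense_open)
  show "open (U \<union> - closure U)" using assms by auto
  have "UNIV \<subseteq> closure U \<union> closure (- closure U)"
    using closure_subset[of "- closure U"] by blast
  then show "closure (U \<union> - closure U) = UNIV" by auto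
qed

text \<open>The almost open sets form a \<open>\<sigma>\<close>-algebra. Complements are the only nontrivial case: the witness for
\<open>- A\<close> is the exterior \<open>- closure U\<close>, because the boundary of \<open>U\<close> is nowhere dense.\<close>

lemma almost_open_borel:
  assumes "A \<in> sets borel"
  shows "almost_open A"
proof -
  have "A \<in> sigma_sets UNIV {S. open S}"
    using assms by (simp add: sets_borel)
  then show ?thesis
  proof induction
    case (Basic a)
    have "comeager UNIV" by (rule comeager_dense_open) auto
    with Basic show ?case unfolding almost_open_def by (intro exI[of _ a]) simp
  next
    case Empty
    have "comeager UNIV" by (rule comeager_dense_open) auto
    then show ?case unfolding almost_open_def by (intro exI[of _ "{}"]) simp
  next
    case (Compl a)
    then obtain U where U: "open U" "comeager {z. z \<in> a \<longleftrightarrow> z \<in> U}"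
      unfolding almost_open_def by blast
    have "comeager ({z. z \<in> a \<longleftrightarrow> z \<in> U} \<inter> (U \<union> - closure U))"
      by (intro comeager_Int U comeager_complement_boundary)
    then have "comeager {z. z \<in> UNIV - a \<longleftrightarrow> z \<in> - closure U}"
      by (rule comeager_mono) (use closure_subset[of U] in auto)
    then show ?case unfolding almost_open_def by (intro exI[of _ "- closure U"]) auto
  next
    case (Union a)
    then obtain U where U: "\<And>i::nat. open (U i)" "\<And>i. comeager {z. z \<in> a i \<longleftrightarrow> z \<in> U i}"
      unfolding almost_open_def by metis
    have "comeager (\<Inter>i. {z. z \<in> a i \<longleftrightarrow> z \<in> U i})"
      by (intro comeager_INT U) auto
    then have "comeager {z. z \<in> (\<Union>i. a i) \<longleftrightarrow> z \<in> (\<Union>i. U i)}"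
      by (rule comeager_mono) auto
    then show ?case unfolding almost_open_def using U(1) by (intro exI[of _ "\<Union>i. U i"]) auto
  qed
qed

text \<open>Take a countable basis of the codomain. Each preimage of a basic set agrees with an open set on a
comeager set, and on the intersection of these countably many comeager sets the preimages of all
open sets are relatively open.\<close>

lemma borel_measurable_continuous_on_comeager:
  fixes f :: "'a::topological_space \<Rightarrow> 'b::second_countable_topology"
  assumes "f \<in> borel_measurable borel"
  obtains \<D> where "countable \<D>" "\<And>D. D \<in> \<D> \<Longrightarrow> open D \<and> closure D = UNIV"
    "continuous_on (\<Inter>\<D>) f"
proof -
  obtain B :: "'b set set" where B: "countable B" "topological_basis B"
    using ex_countable_basis by blast
  have "almost_open (f -` b)" if "b \<in> B" for b
  proof -
    have "f -` b \<inter> space borel \<in> sets borel"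
      using assms B(2) that by (intro measurable_sets[OF assms]) (auto dest: topological_basis_open)
    then show ?thesis by (intro almost_open_borel) simp
  qed
  then obtain U where U: "\<And>b. b \<in> B \<Longrightarrow> open (U b)"
      "\<And>b. b \<in> B \<Longrightarrow> comeager {z. z \<in> f -` b \<longleftrightarrow> z \<in> U b}"
    unfolding almost_open_def by metis
  have "comeager (\<Inter>b\<in>B. {z. z \<in> f -` b \<longleftrightarrow> z \<in> U b})"
    by (intro comeager_INT B(1) U(2))
  then obtain \<D> where D: "countable \<D>" "\<And>D. D \<in> \<D> \<Longrightarrow> open D \<and> closure D = UNIV"
    "\<Inter>\<D> \<subseteq> (\<Inter>b\<in>B. {z. z \<in> f -` b \<longleftrightarrow> z \<in> U b})"
    unfolding comeager_def by auto
  have "continuous_on (\<Inter>\<D>) f"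
    unfolding continuous_on_open_invariant
  proof (intro allI impI)
    fix V :: "'b set" assume "open V"
    then obtain B' where B': "B' \<subseteq> B" "\<Union>B' = V"
      using B(2) unfolding topological_basis_def by metis
    have "open (\<Union>b\<in>B'. U b)" using U(1) B'(1) by blast
    moreover have "(\<Union>b\<in>B'. U b) \<inter> \<Inter>\<D> = f -` V \<inter> \<Inter>\<D>"
      using D(3) B' by blast
    ultimately show "\<exists>A. open A \<and> A \<inter> \<Inter>\<D> = f -` V \<inter> \<Inter>\<D>" by blast
  qed
  with D show ?thesis using that by blast
qed

lemma euclidean_nat_discrete: "(euclidean :: nat topology) = discrete_topology UNIV"
  by (metis discrete_topology_unique_alt openin_subtopology_refl open_discrete open_openin subset_UNIV topspace_euclidean topology_eq openin_discrete_topology)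

lemma comeager_dense_Baire_space:
  fixes A :: "(nat \<Rightarrow> nat) set"
  assumes "comeager A"
  shows "closure A = UNIV"
proof -
  have "completely_metrizable_space (product_topology (\<lambda>_::nat. euclidean :: nat topology) UNIV)"
    unfolding completely_metrizable_space_product_topology
    by (simp add: euclidean_nat_discrete completely_metrizable_space_discrete_topology)
  then have "completely_metrizable_space (euclidean :: (nat \<Rightarrow> nat) topology)"
    by (simp add: euclidean_product_topology)
  moreover obtain \<D> where D: "countable \<D>" "\<And>D. D \<in> \<D> \<Longrightarrow> open D \<and> closure D = UNIV"
    "\<Inter>\<D> \<subseteq> A"
    using assms unfolding comeager_def by auto
  ultimately have "euclidean closure_of \<Inter>\<D> = (UNIV :: (nat \<Rightarrow> nat) set)"
    using Baire_category[of euclidean \<D>] by auto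
  then show ?thesis using closure_mono[OF D(3)] by auto
qed

lemma eventually_nhds_cylinder:
  fixes z :: "nat \<Rightarrow> nat"
  assumes "eventually P (nhds z)"
  obtains k where "\<And>w. (\<And>i. i < k \<Longrightarrow> w i = z i) \<Longrightarrow> P w"
proof -
  obtain S where S: "open S" "z \<in> S" "\<And>w. w \<in> S \<Longrightarrow> P w"
    using assms unfolding eventually_nhds by blast
  then have "openin (product_topology (\<lambda>_::nat. euclidean :: nat topology) UNIV) S"
    by (simp add: open_fun_def)
  with S(2) obtain U where U: "finite {i. U i \<noteq> UNIV}" "z \<in> Pi\<^sub>E UNIV U" "Pi\<^sub>E UNIV U \<subseteq> S"
    unfolding openin_product_topology_alt by fastforce
  obtain k where k: "\<And>i. U i \<noteq> UNIV \<Longrightarrow> i < k"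
    using finite_nat_bounded[OF U(1)] by auto
  show ?thesis
  proof (rule that[of k])
    fix w assume w: "\<And>i. i < k \<Longrightarrow> w i = z i"
    have "w i \<in> U i" for i
      using w[of i] k[of i] U(2) by (cases "i < k") (auto simp: PiE_iff)
    then show "P w" using U(3) S(3) by auto
  qed
qed

lemma open_cylinder: "open {w :: nat \<Rightarrow> nat. \<forall>i<k. w i = z i}"
proof -
  have "open {w :: nat \<Rightarrow> nat. w i = z i}" for i
    using open_vimage[OF open_discrete continuous_on_product_coordinates[of i], of "{z i}"]
    by (simp add: vimage_def)
  moreover have "{w :: nat \<Rightarrow> nat. \<forall>i<k. w i = z i} = (\<Inter>i\<in>{..<k}. {w. w i = z i})" by auto
  ultimately show ?thesis by auto
qed

section \<open>Stabilizing strings in the Baire space\<close>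

lemma dense_iff_meets_open:
  "closure D = UNIV \<longleftrightarrow> (\<forall>S z. open S \<longrightarrow> z \<in> S \<longrightarrow> (\<exists>w\<in>S. w \<in> D))"
  unfolding closure_interior interior_def by blast

text \<open>Changing the first \<open>k\<close> coordinates to those of \<open>p\<close>. For every \<open>p\<close> this pulls dense open sets back to
dense open sets, so that a generic tail stays generic under all of finitely many prefixes.\<close>

definition overwrite :: "nat \<Rightarrow> (nat \<Rightarrow> nat) \<Rightarrow> (nat \<Rightarrow> nat) \<Rightarrow> nat \<Rightarrow> nat" where
  "overwrite k p z = (\<lambda>i. if i < k then p i else z i)"

lemma continuous_on_overwrite: "continuous_on UNIV (overwrite k p)"
proof (rule continuous_on_coordinatewise_then_product)
  show "continuous_on UNIV (\<lambda>z. overwrite k p z i)" for i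
    by (cases "i < k") (auto simp: overwrite_def)
qed

lemma dense_open_overwrite:
  assumes "open D" "closure D = UNIV"
  shows "open {z. overwrite k p z \<in> D}" "closure {z. overwrite k p z \<in> D} = UNIV"
proof -
  show "open {z. overwrite k p z \<in> D}"
    using open_vimage[OF assms(1) continuous_on_overwrite, of k p] by (simp add: vimage_def)
  show "closure {z. overwrite k p z \<in> D} = UNIV"
    unfolding dense_iff_meets_open
  proof (intro allI impI)
    fix S :: "(nat \<Rightarrow> nat) set" and z assume "open S" "z \<in> S"
    then have "eventually (\<lambda>w. w \<in> S) (nhds z)" by (rule eventually_nhds_in_open)
    then obtain k0 where k0: "\<And>w. (\<And>i. i < k0 \<Longrightarrow> w i = z i) \<Longrightarrow> w \<in> S"
      by (rule eventually_nhds_cylinder) blast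
    obtain w where w: "w \<in> D" "\<And>i. i < max k k0 \<Longrightarrow> w i = overwrite k p z i"
      using assms(2)[unfolded dense_iff_meets_open, rule_format,
          OF open_cylinder[of "max k k0" "overwrite k p z"], of "overwrite k p z"] by auto
    have "overwrite k z w \<in> S"
      by (rule k0) (use w(2) in \<open>auto simp: overwrite_def\<close>)
    moreover have "overwrite k p (overwrite k z w) = w"
      using w(2) by (force simp: overwrite_def)
    ultimately show "\<exists>w\<in>S. w \<in> {z. overwrite k p z \<in> D}" using w(1) by force
  qed
qed

lemma finite_bounded_prefixes: "finite {p :: nat \<Rightarrow> nat. \<forall>i. if i < k then p i \<le> M else p i = (0::nat)}"
proof -
  have "finite {p :: nat \<Rightarrow> nat. \<forall>i::nat. (i \<in> {..<k} \<longrightarrow> p i \<in> {..M}) \<and> (i \<notin> {..<k} \<longrightarrow> p i = 0)}"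
    by (rule finite_set_of_finite_funs) auto
  then show ?thesis by (rule rev_finite_subset) (auto split: if_splits)
qed

text \<open>The relatively closed sets \<open>G - E l\<close> cover \<open>G\<close>. If every \<open>E l\<close> met every nonempty open set, the open
sets that induce the \<open>E l\<close> on \<open>G\<close> would be dense, and a generic point would escape the cover.\<close>

lemma countable_closed_cover_of_comeager:
  fixes G :: "(nat \<Rightarrow> nat) set" and E :: "nat \<Rightarrow> (nat \<Rightarrow> nat) set"
  assumes "comeager G"
    and E: "\<And>l. openin (top_of_set G) (E l)"
    and "\<And>z. z \<in> G \<Longrightarrow> \<exists>l. z \<notin> E l"
  shows "\<exists>l S. open S \<and> S \<noteq> {} \<and> S \<inter> E l = {}"
proof (rule ccontr)
  assume no: "\<not> ?thesis"
  obtain T where T: "\<And>l. open (T l)" "\<And>l. E l = G \<inter> T l"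
    using E unfolding openin_open by metis
  have "S \<inter> E l \<noteq> {}" if "open S" "S \<noteq> {}" for S l
    using no that by blast
  then have "closure (T l) = UNIV" for l
    unfolding dense_iff_meets_open T(2) by blast
  then have "comeager (\<Inter>l. T l)" by (intro comeager_INT comeager_dense_open T(1)) auto
  then have "comeager (G \<inter> (\<Inter>l. T l))" by (intro comeager_Int assms)
  from comeager_dense_Baire_space[OF this] obtain z where "z \<in> G \<inter> (\<Inter>l. T l)"
    unfolding dense_iff_meets_open by (meson open_UNIV UNIV_I)
  then show False using assms(3)[of z] T(2) by auto
qed

text \<open>The string \<open>s\<close> on the coordinates \<open>[k, k')\<close>, placed after any of the finitely many prefixes bounded
by \<open>M\<close>, does three things: it forces membership in \<open>D\<close>; it makes \<open>\<psi>\<close> beyond \<open>l\<close> independent of the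
prefix, up to \<open>\<epsilon>\<close>; and it makes \<open>\<psi>\<close> before \<open>l\<close> independent of the coordinates from \<open>k'\<close> on, up to
\<open>\<epsilon>\<close>. The second clause compares prefixes in front of a tail that is generic behind each of them,
since the category argument produces a string that works for all prefixes at once.\<close>

definition stabilizes ::
  "((nat \<Rightarrow> nat) \<Rightarrow> nat \<Rightarrow> real) \<Rightarrow> (nat \<Rightarrow> 'b::real_normed_vector) \<Rightarrow> (nat \<Rightarrow> nat) set \<Rightarrow>
   (nat \<Rightarrow> nat) set \<Rightarrow> nat \<Rightarrow> nat \<Rightarrow> real \<Rightarrow> nat \<Rightarrow> nat \<Rightarrow> (nat \<Rightarrow> nat) \<Rightarrow> bool" where
  "stabilizes \<psi> y G D k M \<epsilon> k' l s \<longleftrightarrow>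
     (\<forall>w. (\<forall>i<k. w i \<le> M) \<longrightarrow> (\<forall>i\<in>{k..<k'}. w i = s i) \<longrightarrow> w \<in> D) \<and>
     (\<forall>w w'. (\<forall>v. (\<forall>i<k. v i \<le> M) \<longrightarrow> (\<forall>i\<ge>k. v i = w i) \<longrightarrow> v \<in> G) \<longrightarrow>
        (\<forall>i<k. w i \<le> M \<and> w' i \<le> M) \<longrightarrow> (\<forall>i\<in>{k..<k'}. w i = s i) \<longrightarrow> (\<forall>i\<ge>k. w i = w' i) \<longrightarrow>
        (\<forall>m\<ge>l. \<forall>n\<ge>m. norm (\<Sum>i=m..<n. (\<psi> w i - \<psi> w' i) *\<^sub>R y i) \<le> \<epsilon>)) \<and>
     (\<forall>w\<in>G. \<forall>w'\<in>G.
        (\<forall>i<k. w i \<le> M \<and> w i = w' i) \<longrightarrow> (\<forall>i\<in>{k..<k'}. w i = s i \<and> w' i = s i) \<longrightarrow>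
        (\<forall>m n. m \<le> n \<longrightarrow> n \<le> l \<longrightarrow> norm (\<Sum>i=m..<n. (\<psi> w i - \<psi> w' i) *\<^sub>R y i) \<le> \<epsilon>))"

lemma stabilizes_mem:
  assumes "stabilizes \<psi> y G D k M \<epsilon> k' l s" "\<And>i. i < k \<Longrightarrow> w i \<le> M"
    "\<And>i. k \<le> i \<Longrightarrow> i < k' \<Longrightarrow> w i = s i"
  shows "w \<in> D"
  using assms unfolding stabilizes_def by auto

lemma stabilizes_tail:
  assumes "stabilizes \<psi> y G D k M \<epsilon> k' l s"
    and "\<And>v. (\<And>i. i < k \<Longrightarrow> v i \<le> M) \<Longrightarrow> (\<And>i. k \<le> i \<Longrightarrow> v i = w i) \<Longrightarrow> v \<in> G"
    and "\<And>i. i < k \<Longrightarrow> w i \<le> M" "\<And>i. i < k \<Longrightarrow> w' i \<le> M"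
    and "\<And>i. k \<le> i \<Longrightarrow> i < k' \<Longrightarrow> w i = s i" "\<And>i. k \<le> i \<Longrightarrow> w i = w' i"
    and "l \<le> m" "m \<le> n"
  shows "norm (\<Sum>i=m..<n. (\<psi> w i - \<psi> w' i) *\<^sub>R y i) \<le> \<epsilon>"
  using assms(1)[unfolded stabilizes_def, THEN conjunct2, THEN conjunct1, rule_format, of w w' m n]
    assms(2-) by simp

lemma stabilizes_head:
  assumes "stabilizes \<psi> y G D k M \<epsilon> k' l s" "w \<in> G" "w' \<in> G"
    and "\<And>i. i < k \<Longrightarrow> w i \<le> M" "\<And>i. i < k \<Longrightarrow> w i = w' i"
    and "\<And>i. k \<le> i \<Longrightarrow> i < k' \<Longrightarrow> w i = s i" "\<And>i. k \<le> i \<Longrightarrow> i < k' \<Longrightarrow> w' i = s i"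
    and "m \<le> n" "n \<le> l"
  shows "norm (\<Sum>i=m..<n. (\<psi> w i - \<psi> w' i) *\<^sub>R y i) \<le> \<epsilon>"
  using assms(1)[unfolded stabilizes_def, THEN conjunct2, THEN conjunct2, rule_format, of w w' m n]
    assms(2-) by simp

text \<open>For a generic tail \<open>z\<close> the images under any two of the finitely many prefixes are equivalent, so there
is an \<open>l\<close> beyond which all their differences have partial sums at most \<open>\<epsilon>\<close>. For fixed \<open>l\<close> this is a
closed condition on \<open>z\<close>, hence one \<open>l\<close> works for all generic tails in some cylinder. Inside it,
continuity of \<open>\<psi>\<close> at the finitely many points \<open>overwrite k p z\<close> and openness of \<open>D\<close> give the other two
properties after lengthening the string.\<close>

lemma stabilizing_string:
  fixes \<psi> :: "(nat \<Rightarrow> nat) \<Rightarrow> nat \<Rightarrow> real" and y :: "nat \<Rightarrow> 'b::banach"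
  assumes \<D>: "countable \<D>" "\<And>D. D \<in> \<D> \<Longrightarrow> open D \<and> closure D = UNIV"
    and cont: "continuous_on (\<Inter>\<D>) \<psi>"
    and fin: "\<And>w w'. finite {i. w i \<noteq> w' i} \<Longrightarrow> (\<lambda>i. \<psi> w i - \<psi> w' i) \<in> coef y"
    and "\<epsilon> > 0" and D: "open D" "\<Inter>\<D> \<subseteq> D"
  shows "\<exists>k'\<ge>k. \<exists>l'\<ge>L. \<exists>s. stabilizes \<psi> y (\<Inter>\<D>) D k M \<epsilon> k' l' s"
proof -
  define P where "P = {p. \<forall>i. if i < k then p i \<le> M else p i = (0::nat)}"
  have finP: "finite P" unfolding P_def by (rule finite_bounded_prefixes)
  define G where "G = \<Inter>\<D>"
  define G' where "G' = {z. \<forall>p\<in>P. overwrite k p z \<in> G}"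
  have G'_eq: "G' = (\<Inter>p\<in>P. \<Inter>D\<in>\<D>. {z. overwrite k p z \<in> D})"
    unfolding G'_def G_def by auto
  have "comeager G'"
    unfolding G'_eq
    by (intro comeager_INT comeager_dense_open dense_open_overwrite countable_finite finP \<D>(1))
       (use \<D>(2) in auto)
  have cF: "continuous_on G (\<lambda>w. \<Sum>i=m..<n. \<psi> w i *\<^sub>R y i)" for m n
  proof -
    have "continuous_on G (\<lambda>w. \<psi> w i)" for i
      using cont unfolding G_def by (rule continuous_on_product_then_coordinatewise)
    then show ?thesis by (intro continuous_on_sum continuous_on_scaleR continuous_on_const)
  qed
  define \<Delta> where "\<Delta> p p' m n z = norm ((\<Sum>i=m..<n. \<psi> (overwrite k p z) i *\<^sub>R y i)
      - (\<Sum>i=m..<n. \<psi> (overwrite k p' z) i *\<^sub>R y i))" for p p' m n z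
  have c\<Delta>: "continuous_on G' (\<Delta> p p' m n)" if "p \<in> P" "p' \<in> P" for p p' m n
  proof -
    have *: "continuous_on G' (\<lambda>z. \<Sum>i=m..<n. \<psi> (overwrite k q z) i *\<^sub>R y i)" if "q \<in> P" for q
      by (rule continuous_on_compose2[OF cF, where f="overwrite k q"])
         (use continuous_on_subset[OF continuous_on_overwrite] that in \<open>auto simp: G'_def\<close>)
    show ?thesis
      unfolding \<Delta>_def using *[OF that(1)] *[OF that(2)]
      by (intro continuous_on_norm continuous_on_diff)
  qed
  \<comment> \<open>the tails for which some two prefixes are still more than \<open>\<epsilon>\<close> apart beyond \<open>l\<close>\<close>
  define E where "E l = (\<Union>p\<in>P. \<Union>p'\<in>P. \<Union>m\<in>{max l L..}. \<Union>n\<in>{m..}. {z\<in>G'. \<epsilon> < \<Delta> p p' m n z})" for l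
  have "openin (top_of_set G') {z\<in>G'. \<epsilon> < \<Delta> p p' m n z}" if "p \<in> P" "p' \<in> P" for p p' m n
    using continuous_openin_preimage_gen[OF c\<Delta>[OF that], of "{\<epsilon><..}" m n]
    by (simp add: vimage_def Int_def)
  then have "openin (top_of_set G') (E l)" for l
    unfolding E_def by (auto intro!: openin_Union)
  moreover have "\<exists>l. z \<notin> E l" if "z \<in> G'" for z
  proof -
    have "\<exists>N. \<forall>m\<ge>N. \<forall>n. \<Delta> p p' m n z < \<epsilon>" for p p'
    proof -
      have "finite {i. overwrite k p z i \<noteq> overwrite k p' z i}"
        by (rule finite_subset[of _ "{..<k}"]) (auto simp: overwrite_def)
      then have "summable (\<lambda>i. (\<psi> (overwrite k p z) i - \<psi> (overwrite k p' z) i) *\<^sub>R y i)"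
        using fin unfolding coef_def by blast
      then show ?thesis
        using \<open>\<epsilon> > 0\<close> unfolding summable_Cauchy \<Delta>_def
        by (simp add: sum_subtractf[symmetric] scaleR_left_diff_distrib)
    qed
    then obtain N where N: "\<And>p p' m n. m \<ge> N p p' \<Longrightarrow> \<Delta> p p' m n z < \<epsilon>" by metis
    define l where "l = Max (insert 0 ((\<lambda>(p,p'). N p p') ` (P \<times> P)))"
    have "N p p' \<le> l" if "p \<in> P" "p' \<in> P" for p p'
      unfolding l_def using finP that by (intro Max_ge) auto
    moreover have "\<Delta> p p' m n z < \<epsilon>" if "p \<in> P" "p' \<in> P" "l \<le> m" for p p' m n
      using N calculation[OF that(1,2)] that(3) order_trans by blast
    ultimately have "z \<notin> E l" unfolding E_def by (simp add: not_less less_imp_le)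
    then show ?thesis ..
  qed
  ultimately obtain l0 S where S: "open S" "S \<noteq> {}" "S \<inter> E l0 = {}"
    using countable_closed_cover_of_comeager[OF \<open>comeager G'\<close>, of E] by blast
  obtain z where z: "z \<in> G'" "z \<in> S"
    using comeager_dense_Baire_space[OF \<open>comeager G'\<close>] S unfolding dense_iff_meets_open by blast
  define l' where "l' = max l0 L"
  have "eventually (\<lambda>w. w \<in> S) (nhds z)" using S z by (intro eventually_nhds_in_open)
  then obtain k0 where k0: "\<And>w. (\<And>i. i < k0 \<Longrightarrow> w i = z i) \<Longrightarrow> w \<in> S"
    by (rule eventually_nhds_cylinder) blast
  define close where "close p w \<longleftrightarrow> w \<in> D \<and> (\<forall>m\<in>{..l'}. \<forall>n\<in>{..l'}. w \<in> G \<longrightarrow>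
      dist (\<Sum>i=m..<n. \<psi> w i *\<^sub>R y i) (\<Sum>i=m..<n. \<psi> (overwrite k p z) i *\<^sub>R y i) < \<epsilon>/2)" for p w
  have "\<exists>k1. \<forall>w. (\<forall>i<k1. w i = overwrite k p z i) \<longrightarrow> close p w" if "p \<in> P" for p
  proof -
    let ?v = "overwrite k p z"
    have v: "?v \<in> G" using z that by (auto simp: G'_def)
    then have 1: "eventually (\<lambda>w. w \<in> D) (nhds ?v)"
      using D by (intro eventually_nhds_in_open) (auto simp: G_def)
    have "\<forall>\<^sub>F w in nhds ?v. w \<in> G \<longrightarrow> dist (\<Sum>i=m..<n. \<psi> w i *\<^sub>R y i)
         (\<Sum>i=m..<n. \<psi> ?v i *\<^sub>R y i) < \<epsilon>/2" for m n
    proof -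
      have "((\<lambda>w. \<Sum>i=m..<n. \<psi> w i *\<^sub>R y i) \<longlongrightarrow> (\<Sum>i=m..<n. \<psi> ?v i *\<^sub>R y i)) (at ?v within G)"
        using cF v unfolding continuous_on_def by blast
      then have "\<forall>\<^sub>F w in at ?v within G. dist (\<Sum>i=m..<n. \<psi> w i *\<^sub>R y i)
         (\<Sum>i=m..<n. \<psi> ?v i *\<^sub>R y i) < \<epsilon>/2"
        using \<open>\<epsilon> > 0\<close> by (intro tendstoD) auto
      then show ?thesis unfolding eventually_at_filter
        by eventually_elim (use \<open>\<epsilon> > 0\<close> in auto)
    qed
    then have "\<forall>\<^sub>F w in nhds ?v. \<forall>m\<in>{..l'}. \<forall>n\<in>{..l'}. w \<in> G \<longrightarrow> dist (\<Sum>i=m..<n. \<psi> w i *\<^sub>R y i)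
         (\<Sum>i=m..<n. \<psi> ?v i *\<^sub>R y i) < \<epsilon>/2"
      by (intro eventually_ball_finite ballI) auto
    from eventually_conj[OF 1 this] have "eventually (close p) (nhds ?v)"
      unfolding close_def by simp
    then show ?thesis by (rule eventually_nhds_cylinder) blast
  qed
  then obtain K where K: "\<And>p w. p \<in> P \<Longrightarrow> (\<And>i. i < K p \<Longrightarrow> w i = overwrite k p z i) \<Longrightarrow> close p w"
    by metis
  define k' where "k' = Max (insert k (insert k0 (K ` P)))"
  have k': "k \<le> k'" "k0 \<le> k'" "\<And>p. p \<in> P \<Longrightarrow> K p \<le> k'"
    unfolding k'_def using finP by (auto intro!: Max_ge simp del: Max_insert)
  define pre where "pre w = (\<lambda>i. if i < k then w i else (0::nat))" for w
  have pre: "pre w \<in> P" if "\<forall>i<k. w i \<le> M" for w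
    using that by (auto simp: pre_def P_def)
  have near: "close (pre w) w"
    if "\<forall>i<k. w i \<le> M" "\<forall>i\<in>{k..<k'}. w i = z i" for w
  proof (rule K[OF pre[OF that(1)]])
    fix i assume "i < K (pre w)"
    then have "i < k'" using k'(3)[OF pre[OF that(1)]] by simp
    then show "w i = overwrite k (pre w) z i"
      using that(2) by (auto simp: overwrite_def pre_def)
  qed
  have tail: "norm (\<Sum>i=m..<n. (\<psi> w i - \<psi> w' i) *\<^sub>R y i) \<le> \<epsilon>"
    if w: "\<And>v. (\<forall>i<k. v i \<le> M) \<Longrightarrow> (\<forall>i\<ge>k. v i = w i) \<Longrightarrow> v \<in> G"
      "\<forall>i<k. w i \<le> M \<and> w' i \<le> M"
      "\<forall>i\<in>{k..<k'}. w i = z i" "\<forall>i\<ge>k. w i = w' i" "l' \<le> m" "m \<le> n" for w w' m n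
  proof -
    let ?w = "overwrite k z w"
    have "?w \<in> S"
      by (rule k0) (use w(3) k'(2) in \<open>auto simp: overwrite_def\<close>)
    then have "?w \<notin> E l0" using S(3) by blast
    moreover have "?w \<in> G'"
      unfolding G'_def by (auto intro!: w(1) simp: P_def overwrite_def split: if_splits)
    moreover have "pre w \<in> P" "pre w' \<in> P" using w(2) by (auto intro: pre)
    moreover have "m \<in> {max l0 L..}" "n \<in> {m..}" using w(5,6) by (auto simp: l'_def)
    ultimately have "\<not> \<epsilon> < \<Delta> (pre w) (pre w') m n ?w" unfolding E_def by blast
    moreover have "overwrite k (pre w) ?w = w" "overwrite k (pre w') ?w = w'"
      using w(4) by (auto simp: overwrite_def pre_def)
    ultimately show ?thesis
      by (simp add: \<Delta>_def sum_subtractf[symmetric] scaleR_left_diff_distrib)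
  qed
  have head: "norm (\<Sum>i=m..<n. (\<psi> w i - \<psi> w' i) *\<^sub>R y i) \<le> \<epsilon>"
    if w: "w \<in> G" "w' \<in> G" "\<forall>i<k. w i \<le> M \<and> w i = w' i"
      "\<forall>i\<in>{k..<k'}. w i = z i \<and> w' i = z i" "m \<le> n" "n \<le> l'" for w w' m n
  proof -
    let ?F = "\<lambda>w. \<Sum>i=m..<n. \<psi> w i *\<^sub>R y i"
    have w1: "\<forall>i<k. w i \<le> M" and z1: "\<forall>i\<in>{k..<k'}. w i = z i" using w(3,4) by blast+
    have w': "\<forall>i<k. w' i \<le> M" using w(3) by metis
    have z': "\<forall>i\<in>{k..<k'}. w' i = z i" using w(4) by blast
    have eq: "pre w' = pre w" using w(3) by (auto simp: pre_def)
    have "dist (?F w) (?F (overwrite k (pre w) z)) < \<epsilon>/2" using near[OF w1 z1] w unfolding close_def by auto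
    moreover have "dist (?F w') (?F (overwrite k (pre w') z)) < \<epsilon>/2" using near[OF w' z'] w unfolding close_def by auto
    ultimately have "dist (?F w) (?F w') < \<epsilon>" unfolding eq by (rule dist_triangle_half_l)
    then show ?thesis
      by (simp add: dist_norm sum_subtractf[symmetric] scaleR_left_diff_distrib)
  qed
  have "w \<in> D" if "\<forall>i<k. w i \<le> M" "\<forall>i\<in>{k..<k'}. w i = z i" for w
    using near[OF that] by (simp add: close_def)
  with tail head have "stabilizes \<psi> y G D k M \<epsilon> k' l' z"
    unfolding stabilizes_def by blast
  moreover have "L \<le> l'" by (simp add: l'_def)
  ultimately show ?thesis using k'(1) unfolding G_def by blast
qed

section \<open>Fusion\<close>

text \<open>For strictly increasing \<open>p\<close> with \<open>p 0 = 0\<close> the intervals \<open>[p j, p (j + 1))\<close> partition the natural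
numbers, and this is the number of the interval that contains \<open>i\<close>.\<close>

definition block_index :: "(nat \<Rightarrow> nat) \<Rightarrow> nat \<Rightarrow> nat" where
  "block_index p i = (THE j. p j \<le> i \<and> i < p (Suc j))"

lemma block_index_eq:
  assumes "strict_mono p" "p j \<le> i" "i < p (Suc j)"
  shows "block_index p i = j"
  unfolding block_index_def
proof (rule the_equality)
  fix j' assume j': "p j' \<le> i \<and> i < p (Suc j')"
  have "p j' < p (Suc j)" "p j < p (Suc j')" using j' assms(2,3) by linarith+
  then show "j' = j" using strict_mono_less[OF assms(1)] by (meson le_antisym less_Suc_eq_le)
qed (use assms in simp)

text \<open>The point \<open>z r\<close> carries the values \<open>r j\<close> at the free coordinates \<open>b j\<close> and fixed stabilizing strings
in between; \<open>B\<close> bounds the values allowed at each free coordinate, which keeps the number of prefixes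
finite at every stage. Two points with the same values from the \<open>j\<close>-th free coordinate on have images
close beyond \<open>p j\<close>, and two points with the same values up to the \<open>j\<close>-th one have images close before
\<open>p (j + 1)\<close>.\<close>

lemma fusion:
  fixes \<psi> :: "(nat \<Rightarrow> nat) \<Rightarrow> nat \<Rightarrow> real" and y :: "nat \<Rightarrow> 'b::banach"
    and B :: "nat \<Rightarrow> nat"
  assumes meas: "\<psi> \<in> borel_measurable borel"
    and fin: "\<And>w w'. finite {i. w i \<noteq> w' i} \<Longrightarrow> (\<lambda>i. \<psi> w i - \<psi> w' i) \<in> coef y"
  obtains b p :: "nat \<Rightarrow> nat" and z :: "(nat \<Rightarrow> nat) \<Rightarrow> nat \<Rightarrow> nat" where
    "strict_mono b" "strict_mono p" "p 0 = 0"
    "\<And>r j. z r (b j) = r j"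
    "\<And>r r' i. i \<notin> range b \<Longrightarrow> z r i = z r' i"
    "\<And>r r' j m n. \<lbrakk>\<And>i. r i \<le> B (b i); \<And>i. r' i \<le> B (b i); \<And>i. j \<le> i \<Longrightarrow> r i = r' i;
        p j \<le> m; m \<le> n\<rbrakk>
      \<Longrightarrow> norm (\<Sum>i=m..<n. (\<psi> (z r) i - \<psi> (z r') i) *\<^sub>R y i) \<le> (1/2)^j"
    "\<And>r r' j m n. \<lbrakk>\<And>i. r i \<le> B (b i); \<And>i. r' i \<le> B (b i); \<And>i. i \<le> j \<Longrightarrow> r i = r' i;
        m \<le> n; n \<le> p (Suc j)\<rbrakk>
      \<Longrightarrow> norm (\<Sum>i=m..<n. (\<psi> (z r) i - \<psi> (z r') i) *\<^sub>R y i) \<le> (1/2)^j"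
proof -
  obtain \<D> where \<D>: "countable \<D>" "\<And>D. D \<in> \<D> \<Longrightarrow> open D \<and> closure D = UNIV"
    and cont: "continuous_on (\<Inter>\<D>) \<psi>"
    using borel_measurable_continuous_on_comeager[OF meas] by blast
  \<comment> \<open>decreasing, so that membership in \<open>D j\<close> for all large \<open>j\<close> suffices to be in \<open>\<Inter>\<D>\<close>\<close>
  define D where "D j = (\<Inter>i\<le>j. from_nat_into (insert UNIV \<D>) i)" for j
  have in_insert: "from_nat_into (insert UNIV \<D>) i \<in> insert UNIV \<D>" for i
    by (intro from_nat_into) auto
  have D_open: "open (D j)" for j
    unfolding D_def using in_insert \<D>(2) by (intro open_INT) (auto, metis open_UNIV)
  have D_sub: "\<Inter>\<D> \<subseteq> D j" for j
    unfolding D_def using in_insert by fastforce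
  have D_lim: "v \<in> \<Inter>\<D>" if v: "\<And>j. j0 \<le> j \<Longrightarrow> v \<in> D j" for v j0
  proof
    fix X assume "X \<in> \<D>"
    then obtain i where i: "X = from_nat_into (insert UNIV \<D>) i"
      using \<D>(1) by (metis countable_insert from_nat_into_surj insertI2)
    have "v \<in> D (max i j0)" by (rule v) simp
    then show "v \<in> X" unfolding D_def i by auto
  qed
  \<comment> \<open>One stage: \<open>k\<close> is the next free coordinate, \<open>l\<close> the place in the image reached so far, and \<open>M\<close>
    bounds all coordinates before \<open>k\<close>.\<close>
  define Q where "Q j = (\<lambda>(k::nat, l::nat, M::nat, _::nat\<Rightarrow>nat) (k', l', M', s).
     k < k' \<and> l < l' \<and> M \<le> M' \<and> B k \<le> M' \<and> (\<forall>i\<in>{Suc k..<k'}. s i \<le> M') \<and>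
     stabilizes \<psi> y (\<Inter>\<D>) (D j) (Suc k) (max M (B k)) ((1/2)^Suc j) k' l' s)" for j
  define P0 where "P0 n = (\<lambda>(k::nat, l::nat, M::nat, s::nat\<Rightarrow>nat). n = (0::nat) \<longrightarrow> k = 0 \<and> l = 0)" for n
  have "\<exists>x. P0 0 x" unfolding P0_def by auto
  moreover have "\<exists>x'. P0 (Suc j) x' \<and> Q j x x'" for x j
  proof -
    obtain k l M s0 where x: "x = (k, l, M, s0)" by (cases x)
    obtain k' l' s where st: "k' \<ge> Suc k" "l' \<ge> Suc l"
      "stabilizes \<psi> y (\<Inter>\<D>) (D j) (Suc k) (max M (B k)) ((1/2)^Suc j) k' l' s"
      using stabilizing_string[OF \<D> cont fin _ D_open D_sub,
          where \<epsilon>="(1/2)^Suc j" and k="Suc k" and L="Suc l" and M="max M (B k)" and j1=j] by auto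
    define M' where "M' = max (max M (B k)) (\<Sum>i\<in>{Suc k..<k'}. s i)"
    have "s i \<le> M'" if "i \<in> {Suc k..<k'}" for i
      using member_le_sum[OF that, of s] unfolding M'_def by auto
    then have "Q j x (k', l', M', s)"
      unfolding Q_def x prod.case using st by (auto simp: M'_def)
    then show ?thesis unfolding P0_def by blast
  qed
  ultimately obtain f where f: "\<And>j. P0 j (f j)" "\<And>j. Q j (f j) (f (Suc j))"
    using dependent_nat_choice[of P0 Q] by blast
  define b where "b j = fst (f j)" for j
  define p where "p j = fst (snd (f j))" for j
  define M where "M j = fst (snd (snd (f j)))" for j
  define s where "s j = snd (snd (snd (f (Suc j))))" for j
  have Qj: "Q j (b j, p j, M j, snd (snd (snd (f j)))) (b (Suc j), p (Suc j), M (Suc j), s j)" for j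
    using f(2)[of j] by (simp add: b_def p_def M_def s_def)
  have "b 0 = 0" and p0: "p 0 = 0" using f(1)[of 0] unfolding P0_def b_def p_def by (auto split: prod.splits)
  note Q = Qj[unfolded Q_def prod.case]
  have "b j < b (Suc j)" "p j < p (Suc j)" for j
    using Q[of j] by simp_all
  then have b: "strict_mono b" and p: "strict_mono p" by (simp_all add: strict_mono_Suc_iff)
  have M: "M j \<le> M (Suc j)" "B (b j) \<le> M (Suc j)"
    "i \<in> {Suc (b j)..<b (Suc j)} \<Longrightarrow> s j i \<le> M (Suc j)" for i j
    using Q[of j] by simp_all
  note Q1 = Q[THEN conjunct2, THEN conjunct2, THEN conjunct2, THEN conjunct2, THEN conjunct2]
  define z where "z r i = (let j = block_index b i in if i = b j then r j else s j i)"
    for r :: "nat \<Rightarrow> nat" and i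
  have z_b: "z r (b j) = r j" for r j
  proof -
    have "block_index b (b j) = j"
      using b by (intro block_index_eq) (auto simp: strict_mono_Suc_iff)
    then show ?thesis by (simp add: z_def)
  qed
  have z_s: "z r i = s j i" if "i \<in> {Suc (b j)..<b (Suc j)}" for r i j
  proof -
    have "block_index b i = j" using b that by (intro block_index_eq) auto
    then show ?thesis using that by (simp add: z_def)
  qed
  have z_out: "z r i = z r' i" if "i \<notin> range b" for r r' i
    using that by (auto simp: z_def Let_def)
  have z_M: "z r i \<le> M j" if r: "\<And>i. r i \<le> B (b i)" and "i < b j" for r i j
    using that(2)
  proof (induction j)
    case 0
    then show ?case using \<open>b 0 = 0\<close> by simp
  next
    case (Suc j)
    consider "i < b j" | "i = b j" | "i \<in> {Suc (b j)..<b (Suc j)}"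
      using Suc.prems by fastforce
    then show ?case
    proof cases
      case 1
      then show ?thesis using Suc.IH M(1)[of j] by linarith
    next
      case 2
      then show ?thesis using z_b r[of j] M(2)[of j] by auto
    next
      case 3
      then show ?thesis using z_s M(3) by auto
    qed
  qed
  have z_M': "z r i \<le> max (M j) (B (b j))" if r: "\<And>i. r i \<le> B (b i)" and "i < Suc (b j)" for r i j
  proof (cases "i = b j")
    case True
    then show ?thesis using z_b[of r j] r[of j] by auto
  next
    case False
    then have "i < b j" using that(2) by simp
    from z_M[OF r this] show ?thesis by auto
  qed
  have M_mono: "max (M j) (B (b j)) \<le> max (M j') (B (b j'))" if "j \<le> j'" for j j'
    using that
  proof (induction rule: dec_induct)
    case (step n)
    then show ?case using M(1,2)[of n] by linarith
  qed simp
  have G: "v \<in> \<Inter>\<D>" if r: "\<And>i. r i \<le> B (b i)" and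
    v: "\<forall>i<Suc (b j). v i \<le> max (M j) (B (b j))" "\<forall>i\<ge>Suc (b j). v i = z r i" for r v j
  proof (rule D_lim)
    fix j' assume j': "j \<le> j'"
    show "v \<in> D j'"
    proof (rule stabilizes_mem[OF Q1])
      fix i assume i: "i < Suc (b j')"
      show "v i \<le> max (M j') (B (b j'))"
      proof (cases "i < Suc (b j)")
        case True
        then show ?thesis using v(1) M_mono[OF j'] order_trans by blast
      next
        case False
        then have "v i = z r i" using v(2) by auto
        then show ?thesis using z_M'[OF r i] by simp
      qed
    next
      fix i assume "Suc (b j') \<le> i" "i < b (Suc j')"
      then have i: "i \<in> {Suc (b j')..<b (Suc j')}" by simp
      have "b j \<le> b j'" using b j' by (simp add: strict_mono_less_eq)
      then show "v i = s j' i" using v(2) z_s[OF i] i by simp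
    qed
  qed
  have zG: "z r \<in> \<Inter>\<D>" if r: "\<And>i. r i \<le> B (b i)" for r
    by (rule G[of r 0, OF r]) (use z_M'[OF r] in auto)
  show thesis
  proof (rule that[OF b p p0 z_b z_out])
    fix r r' j m n
    assume r: "\<And>i. r i \<le> B (b i)" and r': "\<And>i. r' i \<le> B (b i)"
      and eq: "\<And>i. j \<le> i \<Longrightarrow> r i = r' i" and mn: "p j \<le> m" "m \<le> n"
    show "norm (\<Sum>i=m..<n. (\<psi> (z r) i - \<psi> (z r') i) *\<^sub>R y i) \<le> (1/2)^j"
    proof (cases j)
      case 0
      then have "r = r'" using eq by auto
      then show ?thesis by simp
    next
      case (Suc j')
      have "z r i = z r' i" if "i \<ge> Suc (b j')" for i
      proof (cases "i \<in> range b")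
        case True
        then obtain j'' where "i = b j''" by blast
        moreover from this have "j' < j''" using that strict_mono_less[OF b] by (simp add: Suc_le_eq)
        ultimately show ?thesis using z_b eq Suc by simp
      qed (rule z_out)
      then show ?thesis unfolding Suc
        using mn Suc G[OF r, where j=j'] z_M'[OF r] z_M'[OF r'] z_s
        by (intro stabilizes_tail[OF Q1[of j']]) auto
    qed
  next
    fix r r' j m n
    assume r: "\<And>i. r i \<le> B (b i)" and r': "\<And>i. r' i \<le> B (b i)"
      and eq: "\<And>i. i \<le> j \<Longrightarrow> r i = r' i" and mn: "m \<le> n" "n \<le> p (Suc j)"
    have "z r i = z r' i" if "i < Suc (b j)" for i
    proof (cases "i \<in> range b")
      case True
      then obtain j'' where "i = b j''" by blast
      moreover from this have "j'' \<le> j" using that strict_mono_less_eq[OF b] by (simp add: less_Suc_eq_le)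
      ultimately show ?thesis using z_b eq by simp
    qed (rule z_out)
    then have "norm (\<Sum>i=m..<n. (\<psi> (z r) i - \<psi> (z r') i) *\<^sub>R y i) \<le> (1/2)^Suc j"
      using mn zG[OF r] zG[OF r'] z_M'[OF r] z_M'[OF r'] z_s
      by (intro stabilizes_head[OF Q1[of j]]) auto
    also have "\<dots> \<le> (1/2)^j" by simp
    finally show "norm (\<Sum>i=m..<n. (\<psi> (z r) i - \<psi> (z r') i) *\<^sub>R y i) \<le> (1/2)^j" .
  qed
qed

section \<open>Unconditionality from lower semi-homogeneity\<close>

text \<open>A convex function on a cube is largest at a vertex. Carrying \<open>v\<close> along lets the induction change one
coordinate at a time.\<close>

lemma norm_add_sum_le_signs:
  fixes u :: "'i \<Rightarrow> 'b::real_normed_vector"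
  assumes "finite F" "\<And>i. i \<in> F \<Longrightarrow> \<bar>t i\<bar> \<le> 1"
  shows "\<exists>\<epsilon>. range \<epsilon> \<subseteq> {1, -1::real} \<and>
    norm (v + (\<Sum>i\<in>F. t i *\<^sub>R u i)) \<le> norm (v + (\<Sum>i\<in>F. \<epsilon> i *\<^sub>R u i))"
  using assms
proof (induction F arbitrary: v rule: finite_induct)
  case empty
  then show ?case by (intro exI[of _ "\<lambda>_. 1"]) auto
next
  case (insert a F)
  obtain \<epsilon> where \<epsilon>: "range \<epsilon> \<subseteq> {1, -1::real}"
    "norm ((v + t a *\<^sub>R u a) + (\<Sum>i\<in>F. t i *\<^sub>R u i)) \<le> norm ((v + t a *\<^sub>R u a) + (\<Sum>i\<in>F. \<epsilon> i *\<^sub>R u i))"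
    using insert.IH[of "v + t a *\<^sub>R u a"] insert.prems by auto
  define w where "w = v + (\<Sum>i\<in>F. \<epsilon> i *\<^sub>R u i)"
  have t: "\<bar>t a\<bar> \<le> 1" using insert.prems by simp
  have "w + t a *\<^sub>R u a = ((1 + t a)/2) *\<^sub>R (w + u a) + ((1 - t a)/2) *\<^sub>R (w - u a)"
  proof -
    have "((1 + t a)/2) *\<^sub>R (w + u a) + ((1 - t a)/2) *\<^sub>R (w - u a)
        = ((1 + t a)/2 + (1 - t a)/2) *\<^sub>R w + ((1 + t a)/2 - (1 - t a)/2) *\<^sub>R u a"
      by (simp only: scaleR_add_right scaleR_diff_right scaleR_add_left scaleR_diff_left) simp
    moreover have "(1 + t a)/2 + (1 - t a)/2 = 1" "(1 + t a)/2 - (1 - t a)/2 = t a"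
      by (simp_all add: field_simps)
    ultimately show ?thesis by simp
  qed
  then have "norm (w + t a *\<^sub>R u a) \<le> norm (((1 + t a)/2) *\<^sub>R (w + u a)) + norm (((1 - t a)/2) *\<^sub>R (w - u a))"
    by (metis norm_triangle_ineq)
  also have "\<dots> = ((1 + t a)/2) * norm (w + u a) + ((1 - t a)/2) * norm (w - u a)"
    using t by simp
  also have "\<dots> \<le> ((1 + t a)/2) * max (norm (w + u a)) (norm (w - u a))
      + ((1 - t a)/2) * max (norm (w + u a)) (norm (w - u a))"
    using t by (intro add_mono mult_left_mono) auto
  also have "\<dots> = max (norm (w + u a)) (norm (w - u a))" by (simp add: field_simps)
  finally have "\<exists>e\<in>{1,-1}. norm (w + t a *\<^sub>R u a) \<le> norm (w + e *\<^sub>R u a)"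
    by (auto simp: max_def split: if_splits)
  then obtain e where e: "e \<in> {1,-1}" "norm (w + t a *\<^sub>R u a) \<le> norm (w + e *\<^sub>R u a)" by blast
  have eq: "v + (\<Sum>i\<in>insert a F. (\<epsilon>(a := e)) i *\<^sub>R u i) = w + e *\<^sub>R u a"
    using insert.hyps by (simp add: w_def algebra_simps cong: sum.cong) (rule sum.cong; auto)
  have "norm (v + (\<Sum>i\<in>insert a F. t i *\<^sub>R u i)) \<le> norm (w + t a *\<^sub>R u a)"
    using \<epsilon>(2) insert.hyps by (simp add: w_def algebra_simps)
  also have "\<dots> \<le> norm (v + (\<Sum>i\<in>insert a F. (\<epsilon>(a := e)) i *\<^sub>R u i))"
    unfolding eq by (rule e(2))
  finally show ?case using \<epsilon>(1) e(1) by (intro exI[of _ "\<epsilon>(a := e)"]) auto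
qed

text \<open>Were the series with multipliers \<open>t\<close> not Cauchy, there would be blocks of norm at least \<open>e\<close> arbitrarily
far out. On each of them signs do at least as well as \<open>t\<close>, and signs chosen on disjoint blocks glue to
one sequence of signs for which the series diverges.\<close>

lemma summable_bounded_multiplier:
  fixes u :: "nat \<Rightarrow> 'b::banach" and t :: "nat \<Rightarrow> real"
  assumes signs: "\<And>\<epsilon>. range \<epsilon> \<subseteq> {1, -1::real} \<Longrightarrow> summable (\<lambda>n. \<epsilon> n *\<^sub>R u n)"
    and t: "\<And>n. \<bar>t n\<bar> \<le> 1"
  shows "summable (\<lambda>n. t n *\<^sub>R u n)"
proof (rule ccontr)
  assume "\<not> summable (\<lambda>n. t n *\<^sub>R u n)"
  then obtain e where "e > 0" and
    e: "\<And>N. \<exists>m\<ge>N. \<exists>n. e \<le> norm (\<Sum>i\<in>{m..<n}. t i *\<^sub>R u i)"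
    unfolding summable_Cauchy by (auto simp: not_less)
  have "\<exists>m n \<epsilon>. N \<le> m \<and> m < n \<and> range \<epsilon> \<subseteq> {1, -1::real} \<and>
      e \<le> norm (\<Sum>i\<in>{m..<n}. \<epsilon> i *\<^sub>R u i)" for N
  proof -
    obtain m n where mn: "N \<le> m" "e \<le> norm (\<Sum>i\<in>{m..<n}. t i *\<^sub>R u i)"
      using e[of N] by blast
    have "m < n" using mn(2) \<open>e > 0\<close> by (cases "m < n") auto
    obtain \<epsilon> where "range \<epsilon> \<subseteq> {1, -1::real}"
      "norm (0 + (\<Sum>i\<in>{m..<n}. t i *\<^sub>R u i)) \<le> norm (0 + (\<Sum>i\<in>{m..<n}. \<epsilon> i *\<^sub>R u i))"
      using norm_add_sum_le_signs[of "{m..<n}" t 0 u] t by auto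
    then show ?thesis using mn \<open>m < n\<close> by (intro exI[of _ m] exI[of _ n] exI[of _ \<epsilon>]) auto
  qed
  then obtain m n \<epsilon> where
    *: "\<And>N. N \<le> m N" "\<And>N. m N < n N" "\<And>N. range (\<epsilon> N) \<subseteq> {1, -1::real}"
       "\<And>N. e \<le> norm (\<Sum>i\<in>{m N..<n N}. \<epsilon> N i *\<^sub>R u i)"
    by metis
  define p where "p k = (n ^^ k) 0" for k
  have p_Suc: "p (Suc k) = n (p k)" and "p 0 = 0" for k by (simp_all add: p_def)
  have "p k < p (Suc k)" for k using *(1,2)[of "p k"] p_Suc by simp
  then have p: "strict_mono p" by (simp add: strict_mono_Suc_iff)
  define \<sigma> where "\<sigma> i = \<epsilon> (p (block_index p i)) i" for i
  have "\<sigma> i \<in> {1, -1}" for i using *(3)[of "p (block_index p i)"] unfolding \<sigma>_def by blast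
  then have "summable (\<lambda>i. \<sigma> i *\<^sub>R u i)" by (intro signs) blast
  then obtain N where N: "\<And>m n. N \<le> m \<Longrightarrow> norm (\<Sum>i\<in>{m..<n}. \<sigma> i *\<^sub>R u i) < e"
    using \<open>e > 0\<close> unfolding summable_Cauchy by metis
  have "\<sigma> i = \<epsilon> (p N) i" if "i \<in> {m (p N)..<n (p N)}" for i
  proof -
    have "block_index p i = N"
      using that *(1)[of "p N"] by (intro block_index_eq[OF p]) (auto simp: p_Suc)
    then show ?thesis by (simp add: \<sigma>_def)
  qed
  then have "(\<Sum>i\<in>{m (p N)..<n (p N)}. \<sigma> i *\<^sub>R u i) = (\<Sum>i\<in>{m (p N)..<n (p N)}. \<epsilon> (p N) i *\<^sub>R u i)"
    by (intro sum.cong) auto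
  moreover have "N \<le> m (p N)"
    using strict_mono_imp_increasing[OF p, of N] *(1)[of "p N"] by simp
  ultimately show False using N[of "m (p N)" "n (p N)"] *(4)[of "p N"] by simp
qed

text \<open>The sequence \<open>(\<epsilon> n y n)\<close> is itself a normalized block basis of \<open>y\<close>.\<close>

lemma coef_sign_change:
  assumes "normalized y" "lower_semi_homogeneous y" "c \<in> coef y" "range \<epsilon> \<subseteq> {1, -1::real}"
  shows "(\<lambda>n. \<epsilon> n * c n) \<in> coef y"
proof -
  define u where "u n = \<epsilon> n *\<^sub>R y n" for n
  have \<epsilon>: "\<epsilon> n = 1 \<or> \<epsilon> n = -1" for n using assms(4) by auto
  then have abs: "\<bar>\<epsilon> n\<bar> = 1" "\<epsilon> n * \<epsilon> n = 1" for n by (metis abs_1 abs_minus mult_1 minus_mult_minus)+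
  have "normalized u" using assms(1) abs by (simp add: normalized_def u_def)
  moreover have "block_basis y u"
    unfolding block_basis_def
  proof (intro exI[of _ "\<lambda>j. j"] exI[of _ \<epsilon>] conjI allI)
    show "u j \<noteq> 0" for j using \<open>normalized u\<close> unfolding normalized_def by (metis norm_zero zero_neq_one)
  qed (auto simp: strict_mono_def u_def)
  ultimately have "coef u \<subseteq> coef y"
    using assms(2) unfolding lower_semi_homogeneous_def dominates_def by blast
  moreover have "(\<lambda>n. \<epsilon> n * c n) \<in> coef u"
  proof -
    have "(\<epsilon> n * c n) *\<^sub>R u n = c n *\<^sub>R y n" for n
      using abs(2)[of n] by (simp add: u_def algebra_simps)
    then show ?thesis using assms(3) by (simp add: coef_def)
  qed
  ultimately show ?thesis by blast
qed

lemma coef_solid: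
  fixes y :: "nat \<Rightarrow> 'b::banach"
  assumes "normalized y" "lower_semi_homogeneous y" "c \<in> coef y"
    and d: "\<And>n. \<bar>d n\<bar> \<le> C * \<bar>c n\<bar>"
  shows "d \<in> coef y"
proof -
  define t where "t n = d n / (C * c n)" for n
  have t: "\<bar>t n\<bar> \<le> 1" for n
  proof -
    have "\<bar>d n\<bar> \<le> \<bar>C * c n\<bar>" using d[of n] by (simp add: abs_mult) (meson abs_ge_self abs_ge_zero mult_right_mono order_trans)
    then show ?thesis by (simp add: t_def divide_le_eq_1) blast
  qed
  have "summable (\<lambda>n. t n *\<^sub>R (c n *\<^sub>R y n))"
  proof (rule summable_bounded_multiplier[OF _ t])
    fix \<epsilon> :: "nat \<Rightarrow> real" assume "range \<epsilon> \<subseteq> {1, -1}"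
    from coef_sign_change[OF assms(1-3) this] show "summable (\<lambda>n. \<epsilon> n *\<^sub>R (c n *\<^sub>R y n))"
      by (simp add: coef_def)
  qed
  then have "summable (\<lambda>n. C *\<^sub>R (t n *\<^sub>R (c n *\<^sub>R y n)))" by (rule summable_scaleR_right)
  moreover have "d n = C * t n * c n" for n
    using d[of n] by (cases "C * c n = 0") (auto simp: t_def)
  ultimately show ?thesis by (simp add: coef_def mult.assoc)
qed

lemma coef_add: "a \<in> coef x \<Longrightarrow> b \<in> coef x \<Longrightarrow> (\<lambda>n. a n + b n) \<in> coef x"
  unfolding coef_def by (auto simp: scaleR_left_distrib intro: summable_add)

lemma coef_diff: "a \<in> coef x \<Longrightarrow> b \<in> coef x \<Longrightarrow> (\<lambda>n. a n - b n) \<in> coef x"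
  unfolding coef_def by (auto simp: scaleR_left_diff_distrib intro: summable_diff)

lemma coef_absolutely_summable:
  fixes x :: "nat \<Rightarrow> 'a::banach"
  assumes "normalized x" "summable (\<lambda>n. \<bar>d n\<bar>)"
  shows "d \<in> coef x"
  unfolding coef_def using assms
  by (auto intro!: summable_norm_cancel[of "\<lambda>n. d n *\<^sub>R x n"] simp: normalized_def)

text \<open>Normalize the block sums, and replace those that are \<open>0\<close> by the basis vector at the start of the
block. This is a normalized block basis, and the given series is its series with the block norms as
coefficients.\<close>

lemma block_norms_in_coef:
  fixes y :: "nat \<Rightarrow> 'b::real_normed_vector"
  assumes "normalized y" "lower_semi_homogeneous y" and p: "strict_mono p" "p 0 = (0::nat)"
    and "h \<in> coef y"
  shows "(\<lambda>j. norm (\<Sum>i=p j..<p (Suc j). h i *\<^sub>R y i)) \<in> coef y"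
proof -
  have p_less: "p j < p (Suc j)" for j using p(1) by (simp add: strict_mono_Suc_iff)
  define u where "u j = (\<Sum>i=p j..<p (Suc j). h i *\<^sub>R y i)" for j
  define v where "v j = (if u j = 0 then y (p j) else u j /\<^sub>R norm (u j))" for j
  define \<alpha> where "\<alpha> i = (let j = block_index p i in
      if u j = 0 then (if i = p j then 1 else 0) else h i / norm (u j))" for i
  have "normalized v" using assms(1) by (simp add: normalized_def v_def)
  moreover have "block_basis y v"
    unfolding block_basis_def
  proof (intro exI[of _ p] exI[of _ \<alpha>] conjI allI p(1))
    fix j
    show "v j \<noteq> 0" using \<open>normalized v\<close> unfolding normalized_def by (metis norm_zero zero_neq_one)
    have idx: "block_index p i = j" if "i \<in> {p j..<p (Suc j)}" for i
      using that by (intro block_index_eq[OF p(1)]) auto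
    show "v j = (\<Sum>i=p j..<p (Suc j). \<alpha> i *\<^sub>R y i)"
    proof (cases "u j = 0")
      case True
      have "(\<Sum>i=p j..<p (Suc j). \<alpha> i *\<^sub>R y i) = (\<Sum>i=p j..<p (Suc j). if i = p j then y i else 0)"
        using True idx by (intro sum.cong) (auto simp: \<alpha>_def Let_def)
      then show ?thesis using True p_less[of j] by (simp add: v_def)
    next
      case False
      have "(\<Sum>i=p j..<p (Suc j). \<alpha> i *\<^sub>R y i) = (\<Sum>i=p j..<p (Suc j). (h i *\<^sub>R y i) /\<^sub>R norm (u j))"
        using False idx by (intro sum.cong) (auto simp: \<alpha>_def Let_def divide_inverse mult.commute)
      then show ?thesis
        using False unfolding v_def scaleR_sum_right[symmetric] u_def[symmetric] by simp
    qed
  qed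
  ultimately have "coef v \<subseteq> coef y"
    using assms(2) unfolding lower_semi_homogeneous_def dominates_def by blast
  moreover have "(\<lambda>j. norm (u j)) \<in> coef v"
  proof -
    have partial: "(\<Sum>j<n. u j) = (\<Sum>i<p n. h i *\<^sub>R y i)" for n
    proof (induction n)
      case (Suc n)
      have "(\<Sum>i<p (Suc n). h i *\<^sub>R y i) = (\<Sum>i<p n. h i *\<^sub>R y i) + u n"
        unfolding u_def lessThan_atLeast0 using p_less[of n] by (simp add: sum.atLeastLessThan_concat)
      then show ?case using Suc by simp
    qed (simp add: p(2))
    obtain l where "(\<lambda>n. \<Sum>i<n. h i *\<^sub>R y i) \<longlonglongrightarrow> l"
      using \<open>h \<in> coef y\<close> unfolding coef_def summable_def sums_def by blast
    from LIMSEQ_subseq_LIMSEQ[OF this p(1)] have "summable u"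
      unfolding summable_def sums_def partial by (auto simp: o_def)
    moreover have "norm (u j) *\<^sub>R v j = u j" for j by (simp add: v_def)
    ultimately show ?thesis by (simp add: coef_def)
  qed
  ultimately show ?thesis unfolding u_def by blast
qed

section \<open>Oscillation over a block\<close>

text \<open>The size of \<open>h\<close> on the block \<open>[m, n)\<close>, measured on all subintervals. Unlike the norm of the sum over the
whole block, it controls the partial sums inside the block directly, without a basis constant.\<close>

definition osc :: "(nat \<Rightarrow> 'b::real_normed_vector) \<Rightarrow> nat \<Rightarrow> nat \<Rightarrow> (nat \<Rightarrow> real) \<Rightarrow> real" where
  "osc y m n h = Max ((\<lambda>(p, q). norm (\<Sum>i=p..<q. h i *\<^sub>R y i)) ` {(p, q). m \<le> p \<and> p \<le> q \<and> q \<le> n})"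

lemma finite_subintervals: "finite {(p, q). m \<le> p \<and> p \<le> q \<and> q \<le> (n::nat)}"
  by (rule finite_subset[of _ "{..n} \<times> {..n}"]) auto

lemma norm_sum_le_osc:
  "m \<le> p \<Longrightarrow> p \<le> q \<Longrightarrow> q \<le> n \<Longrightarrow> norm (\<Sum>i=p..<q. h i *\<^sub>R y i) \<le> osc y m n h"
  unfolding osc_def using finite_subintervals by (intro Max_ge) auto

lemma osc_attained:
  assumes "m \<le> n"
  obtains p q where "m \<le> p" "p \<le> q" "q \<le> n" "osc y m n h = norm (\<Sum>i=p..<q. h i *\<^sub>R y i)"
proof -
  have "osc y m n h \<in> (\<lambda>(p, q). norm (\<Sum>i=p..<q. h i *\<^sub>R y i)) ` {(p, q). m \<le> p \<and> p \<le> q \<and> q \<le> n}"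
    unfolding osc_def using finite_subintervals assms by (intro Max_in) auto
  then show ?thesis using that by auto
qed

lemma osc_leI:
  assumes "m \<le> n" "\<And>p q. m \<le> p \<Longrightarrow> p \<le> q \<Longrightarrow> q \<le> n \<Longrightarrow> norm (\<Sum>i=p..<q. h i *\<^sub>R y i) \<le> c"
  shows "osc y m n h \<le> c"
  using osc_attained[OF assms(1), of y h] assms(2) by metis

lemma osc_nonneg: "m \<le> n \<Longrightarrow> 0 \<le> osc y m n h"
  by (rule osc_attained[of m n y h]) auto

lemma osc_cong:
  assumes "\<And>i. m \<le> i \<Longrightarrow> i < n \<Longrightarrow> h i = h' i"
  shows "osc y m n h = osc y m n h'"
  unfolding osc_def using assms by (intro arg_cong[where f=Max] image_cong) (auto intro!: arg_cong[where f=norm] sum.cong)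

lemma osc_minus_commute: "osc y m n (\<lambda>i. h i - h' i) = osc y m n (\<lambda>i. h' i - h i)"
proof -
  have "norm (\<Sum>i=p..<q. (h i - h' i) *\<^sub>R y i) = norm (\<Sum>i=p..<q. (h' i - h i) *\<^sub>R y i)" for p q
    by (subst norm_minus_cancel[symmetric]) (simp add: scaleR_left_diff_distrib flip: sum_negf)
  then show ?thesis unfolding osc_def by simp
qed

lemma osc_add:
  assumes "m \<le> n"
  shows "osc y m n (\<lambda>i. h i + h' i) \<le> osc y m n h + osc y m n h'"
proof -
  obtain p q where pq: "m \<le> p" "p \<le> q" "q \<le> n"
    "osc y m n (\<lambda>i. h i + h' i) = norm (\<Sum>i=p..<q. (h i + h' i) *\<^sub>R y i)"
    using osc_attained[OF assms] by blast
  have "\<dots> \<le> norm (\<Sum>i=p..<q. h i *\<^sub>R y i) + norm (\<Sum>i=p..<q. h' i *\<^sub>R y i)"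
    by (simp add: scaleR_left_distrib sum.distrib norm_triangle_ineq)
  also have "\<dots> \<le> osc y m n h + osc y m n h'"
    using pq by (intro add_mono norm_sum_le_osc)
  finally show ?thesis using pq(4) by simp
qed

text \<open>The triangle inequality along the path \<open>g 0, \<dots>, g q\<close>.\<close>

lemma osc_walk:
  assumes "m \<le> n"
  shows "osc y m n (\<lambda>i. g q i - g 0 i) \<le> (\<Sum>k<q. osc y m n (\<lambda>i. g (Suc k) i - g k i))"
proof (induction q)
  case 0
  have "osc y m n (\<lambda>i. 0) = 0" using osc_attained[OF assms, of y "\<lambda>i. 0"] by auto
  then show ?case by simp
next
  case (Suc q)
  have "osc y m n (\<lambda>i. g (Suc q) i - g 0 i) = osc y m n (\<lambda>i. (g q i - g 0 i) + (g (Suc q) i - g q i))"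
    by simp
  also have "\<dots> \<le> osc y m n (\<lambda>i. g q i - g 0 i) + osc y m n (\<lambda>i. g (Suc q) i - g q i)"
    by (rule osc_add[OF assms])
  finally show ?case using Suc.IH by simp
qed

lemma coef_if_summable_osc:
  fixes y :: "nat \<Rightarrow> 'b::banach"
  assumes p: "strict_mono p" "p 0 = (0::nat)"
    and osc: "\<And>j. osc y (p j) (p (Suc j)) h \<le> \<eta> j" and "summable \<eta>"
  shows "h \<in> coef y"
proof -
  have p_le: "p j \<le> p (Suc j)" for j using p(1) by (simp add: strict_mono_less_eq)
  have \<eta>: "0 \<le> \<eta> j" for j using osc_nonneg[OF p_le] osc order_trans by blast
  have bound: "norm (\<Sum>i\<in>{m..<n}. h i *\<^sub>R y i) \<le> (\<Sum>j=J..<N. \<eta> j)"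
    if "p J \<le> m" "m \<le> n" "n \<le> p N" "J \<le> N" for J N m n
    using that(4,1-3)
  proof (induction N arbitrary: n rule: dec_induct)
    case base
    then show ?case by simp
  next
    case (step N)
    have blk: "norm (\<Sum>i\<in>{m'..<n}. h i *\<^sub>R y i) \<le> \<eta> N" if "p N \<le> m'" "m' \<le> n" for m'
      using norm_sum_le_osc[OF that step.prems(3), of h y] osc[of N] by linarith
    consider "n \<le> p N" | "p N < n" "m \<le> p N" | "p N < m" by linarith
    then show ?case
    proof cases
      case 1
      then show ?thesis using step.IH[of n] step.prems step.hyps \<eta>[of N] by simp
    next
      case 2
      have "(\<Sum>i\<in>{m..<n}. h i *\<^sub>R y i) = (\<Sum>i\<in>{m..<p N}. h i *\<^sub>R y i) + (\<Sum>i\<in>{p N..<n}. h i *\<^sub>R y i)"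
        using 2 by (simp add: sum.atLeastLessThan_concat)
      also have "norm \<dots> \<le> (\<Sum>j=J..<N. \<eta> j) + \<eta> N"
        using 2 step.prems by (intro norm_triangle_mono step.IH blk) auto
      finally show ?thesis using step.hyps by simp
    next
      case 3
      then have "norm (\<Sum>i\<in>{m..<n}. h i *\<^sub>R y i) \<le> \<eta> N" using step.prems by (intro blk) auto
      moreover have "0 \<le> (\<Sum>j=J..<N. \<eta> j)" using \<eta> by (intro sum_nonneg) auto
      ultimately show ?thesis using step.hyps by simp
    qed
  qed
  have "summable (\<lambda>i. h i *\<^sub>R y i)"
    unfolding summable_Cauchy
  proof (intro allI impI)
    fix e :: real assume "e > 0"
    then obtain J where J: "\<And>m n. J \<le> m \<Longrightarrow> norm (sum \<eta> {m..<n}) < e"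
      using \<open>summable \<eta>\<close> unfolding summable_Cauchy by metis
    have "norm (\<Sum>i\<in>{m..<n}. h i *\<^sub>R y i) < e" if "p J \<le> m" for m n
    proof (cases "m \<le> n")
      case True
      have "n \<le> p (max n J)" using strict_mono_imp_increasing[OF p(1), of "max n J"] by simp
      then have "norm (\<Sum>i\<in>{m..<n}. h i *\<^sub>R y i) \<le> sum \<eta> {J..<max n J}"
        using that True by (intro bound) auto
      also have "\<dots> < e" using J[of J "max n J"] by simp
      finally show ?thesis .
    qed (use \<open>e > 0\<close> in simp)
    then show "\<exists>N. \<forall>m\<ge>N. \<forall>n. norm (\<Sum>i\<in>{m..<n}. h i *\<^sub>R y i) < e" by blast
  qed
  then show ?thesis by (simp add: coef_def)
qed

text \<open>Walk from \<open>0\<close> in steps of length \<open>k\<close> until at least \<open>N / 2\<close> is reached. As \<open>2 k \<le> N\<close>, the walk stops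
at some \<open>q k \<le> N\<close> after \<open>q \<le> N / k\<close> steps, and together they cover an oscillation of at least \<open>\<delta>\<close>.\<close>

lemma exists_long_step:
  fixes g :: "nat \<Rightarrow> nat \<Rightarrow> real"
  assumes "m \<le> n" and N: "0 < N" "2 * k \<le> N"
    and sep: "\<And>t. t \<le> N \<Longrightarrow> N \<le> 2 * t \<Longrightarrow> \<delta> \<le> osc y m n (\<lambda>i. g t i - g 0 i)" and "\<delta> > 0"
  obtains t where "t + k \<le> N" "\<delta> * (real k / real N) \<le> osc y m n (\<lambda>i. g (t + k) i - g t i)"
proof (cases "k = 0")
  case True
  then show ?thesis using that[of 0] osc_nonneg[OF \<open>m \<le> n\<close>, of y "\<lambda>i. 0"] by simp
next
  case False
  define q where "q = (LEAST q. N \<le> 2 * (q * k))"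
  have "N \<le> 2 * (N * k)" using False by (simp add: mult.assoc[symmetric])
  then have q: "N \<le> 2 * (q * k)" unfolding q_def by (rule LeastI)
  then have "q > 0" using N(1) by (cases q) auto
  then obtain q' where q': "q = Suc q'" using gr0_implies_Suc by blast
  have "\<not> N \<le> 2 * (q' * k)" using not_less_Least[of q' "\<lambda>q. N \<le> 2 * (q * k)"] q' unfolding q_def by simp
  then have qN: "q * k \<le> N" using N(2) q' by simp
  have "\<exists>i<q. \<delta> * (real k / real N) \<le> osc y m n (\<lambda>l. g (Suc i * k) l - g (i * k) l)"
  proof (rule ccontr)
    assume "\<not> ?thesis"
    then have "(\<Sum>i<q. osc y m n (\<lambda>l. g (Suc i * k) l - g (i * k) l)) < (\<Sum>i<q. \<delta> * (real k / real N))"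
      using \<open>q > 0\<close> by (intro sum_strict_mono) (auto simp: not_le)
    also have "\<dots> = \<delta> * (real (q * k) / real N)" by simp
    also have "\<dots> \<le> \<delta>" using qN N(1) \<open>\<delta> > 0\<close> by (simp add: field_simps flip: of_nat_mult)
    also have "\<delta> \<le> osc y m n (\<lambda>l. g (q * k) l - g (0 * k) l)" using sep[OF qN q] by simp
    also have "\<dots> \<le> (\<Sum>i<q. osc y m n (\<lambda>l. g (Suc i * k) l - g (i * k) l))"
      by (rule osc_walk[OF \<open>m \<le> n\<close>, of y "\<lambda>i. g (i * k)"])
    finally show False by simp
  qed
  then obtain i where i: "i < q" "\<delta> * (real k / real N) \<le> osc y m n (\<lambda>l. g (Suc i * k) l - g (i * k) l)"
    by blast
  have "Suc i * k \<le> q * k" using i(1) by (intro mult_le_mono1) simp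
  then have "i * k + k \<le> N" using qN by simp
  then show ?thesis using that[of "i * k"] i(2) by (simp add: add.commute)
qed

section \<open>Reductions in product form\<close>

text \<open>A reduction that acts block by block. On sequences with values in the grids \<open>{t / 2 ^ b j | t \<le> 2 ^ b j}\<close>
placed at the coordinates \<open>b j\<close>, the \<open>j\<close>-th block \<open>[p j, p (j + 1))\<close> of the image is a function \<open>f j\<close>
of the \<open>j\<close>-th numerator alone.\<close>

definition product_reduction ::
  "(nat \<Rightarrow> 'a::real_normed_vector) \<Rightarrow> (nat \<Rightarrow> 'b::real_normed_vector) \<Rightarrow> (nat \<Rightarrow> nat) \<Rightarrow>
   (nat \<Rightarrow> nat) \<Rightarrow> (nat \<Rightarrow> nat \<Rightarrow> nat \<Rightarrow> real) \<Rightarrow> bool" where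
  "product_reduction x y b p f \<longleftrightarrow> strict_mono b \<and> strict_mono p \<and> p 0 = 0 \<and>
     (\<forall>r r'. (\<forall>j. r j \<le> 2 ^ b j) \<longrightarrow> (\<forall>j. r' j \<le> 2 ^ b j) \<longrightarrow>
        (\<lambda>j. (real (r j) - real (r' j)) / 2 ^ b j) \<in> coef (\<lambda>j. x (b j)) \<longleftrightarrow>
        (\<lambda>i. let j = block_index p i in f j (r j) i - f j (r' j) i) \<in> coef y)"

text \<open>Here \<open>f j t\<close> is the image of the fused point with value \<open>t\<close> at the \<open>j\<close>-th free coordinate and \<open>0\<close> at
all the others. On the \<open>j\<close>-th block it agrees with the image of any \<open>r\<close> with \<open>r j = t\<close> up to
\<open>2 (1/2)^j\<close>, by way of the point that keeps \<open>r\<close> up to \<open>j\<close> and is \<open>0\<close> afterwards. These errors are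
summable, so replacing the images by the values of \<open>f\<close> respects \<open>coef y\<close>.\<close>

lemma borel_reducible_imp_product_reduction:
  fixes x :: "nat \<Rightarrow> 'a::banach" and y :: "nat \<Rightarrow> 'b::banach"
  assumes "borel_reducible (coef_rel x) (coef_rel y)"
  obtains b p f where "product_reduction x y b p f"
proof -
  obtain \<theta> where \<theta>: "\<theta> \<in> borel_measurable borel"
    "\<And>a c. (a, c) \<in> coef_rel x \<longleftrightarrow> (\<theta> a, \<theta> c) \<in> coef_rel y"
    using assms unfolding borel_reducible_def by blast
  define \<phi> where "\<phi> w = (\<lambda>i. real (w i) / 2 ^ i)" for w :: "nat \<Rightarrow> nat"
  define \<psi> where "\<psi> w = \<theta> (\<phi> w)" for w
  have "continuous_on UNIV (\<lambda>w. \<phi> w i)" for i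
  proof -
    have "continuous_on UNIV (\<lambda>w :: nat \<Rightarrow> nat. real (w i))"
      using continuous_on_compose2[of UNIV real UNIV "\<lambda>w. w i"]
      by (auto simp: continuous_on_open_vimage[of UNIV real] open_discrete)
    then show ?thesis unfolding \<phi>_def by (intro continuous_on_divide continuous_on_const) auto
  qed
  then have "continuous_on UNIV \<phi>" by (rule continuous_on_coordinatewise_then_product)
  then have meas: "\<psi> \<in> borel_measurable borel"
    unfolding \<psi>_def by (rule measurable_compose[OF borel_measurable_continuous_onI \<theta>(1)])
  have iff: "(\<lambda>i. \<psi> w i - \<psi> w' i) \<in> coef y \<longleftrightarrow> (\<lambda>i. \<phi> w i - \<phi> w' i) \<in> coef x" for w w'
    using \<theta>(2)[of "\<phi> w" "\<phi> w'"] by (simp add: coef_rel_def \<psi>_def)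
  have fin: "(\<lambda>i. \<psi> w i - \<psi> w' i) \<in> coef y" if "finite {i. w i \<noteq> w' i}" for w w'
  proof -
    have "summable (\<lambda>i. (\<phi> w i - \<phi> w' i) *\<^sub>R x i)"
      by (rule summable_finite[OF that]) (auto simp: \<phi>_def)
    then show ?thesis using iff[of w w'] by (simp add: coef_def)
  qed
  obtain b p z where b: "strict_mono b" and p: "strict_mono p" "p 0 = 0"
    and z: "\<And>r j. z r (b j) = r j" "\<And>r r' i. i \<notin> range b \<Longrightarrow> z r i = z r' i"
    and tail: "\<And>r r' j m n. \<lbrakk>\<And>i. r i \<le> 2 ^ b i; \<And>i. r' i \<le> 2 ^ b i; \<And>i. j \<le> i \<Longrightarrow> r i = r' i;
        p j \<le> m; m \<le> n\<rbrakk>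
      \<Longrightarrow> norm (\<Sum>i=m..<n. (\<psi> (z r) i - \<psi> (z r') i) *\<^sub>R y i) \<le> (1/2)^j"
    and head: "\<And>r r' j m n. \<lbrakk>\<And>i. r i \<le> 2 ^ b i; \<And>i. r' i \<le> 2 ^ b i; \<And>i. i \<le> j \<Longrightarrow> r i = r' i;
        m \<le> n; n \<le> p (Suc j)\<rbrakk>
      \<Longrightarrow> norm (\<Sum>i=m..<n. (\<psi> (z r) i - \<psi> (z r') i) *\<^sub>R y i) \<le> (1/2)^j"
    using fusion[OF meas fin, of "\<lambda>i. 2 ^ i"] by blast
  have p_le: "p j \<le> p (Suc j)" for j using p(1) by (simp add: strict_mono_less_eq)
  define g where "g r = \<psi> (z r)" for r
  define f where "f j t = g (\<lambda>i. if i = j then t else 0)" for j t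
  have local: "osc y (p j) (p (Suc j)) (\<lambda>i. g r i - f j (r j) i) \<le> 2 * (1/2)^j"
    if r: "\<And>j. r j \<le> 2 ^ b j" for r j
  proof -
    define r' where "r' i = (if i \<le> j then r i else 0)" for i
    define r'' where "r'' i = (if i = j then r j else 0)" for i
    have r': "r' i \<le> 2 ^ b i" "r'' i \<le> 2 ^ b i" for i using r by (auto simp: r'_def r''_def)
    have 1: "osc y (p j) (p (Suc j)) (\<lambda>i. g r i - g r' i) \<le> (1/2)^j"
      unfolding g_def by (intro osc_leI p_le head r r') (auto simp: r'_def)
    have 2: "osc y (p j) (p (Suc j)) (\<lambda>i. g r' i - g r'' i) \<le> (1/2)^j"
      unfolding g_def by (intro osc_leI p_le tail r r') (auto simp: r'_def r''_def)
    have "f j (r j) = g r''" unfolding f_def r''_def ..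
    then show ?thesis
      using osc_add[OF p_le, of y j "\<lambda>i. g r i - g r' i" "\<lambda>i. g r' i - g r'' i"] 1 2 by simp
  qed
  have "product_reduction x y b p f"
    unfolding product_reduction_def
  proof (intro conjI allI impI b p)
    fix r r' :: "nat \<Rightarrow> nat"
    assume r: "\<forall>j. r j \<le> 2 ^ b j" and r': "\<forall>j. r' j \<le> 2 ^ b j"
    define h where "h i = (let j = block_index p i in f j (r j) i - f j (r' j) i)" for i
    define d where "d i = (g r i - g r' i) - h i" for i
    have "osc y (p j) (p (Suc j)) d \<le> 4 * (1/2)^j" for j
    proof -
      have "osc y (p j) (p (Suc j)) d =
          osc y (p j) (p (Suc j)) (\<lambda>i. (g r i - f j (r j) i) + (f j (r' j) i - g r' i))"
        using block_index_eq[OF p(1)] by (intro osc_cong) (simp add: d_def h_def Let_def)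
      also have "\<dots> \<le> 2 * (1/2)^j + 2 * (1/2)^j"
        using local[of r j] local[of r' j] r r'
        by (intro order_trans[OF osc_add[OF p_le]] add_mono) (auto simp: osc_minus_commute[of y _ _ "f j (r' j)"])
      finally show ?thesis by simp
    qed
    then have d: "d \<in> coef y"
      by (rule coef_if_summable_osc[OF p]) (intro summable_mult summable_geometric; simp)
    have "h \<in> coef y \<longleftrightarrow> (\<lambda>i. g r i - g r' i) \<in> coef y"
    proof
      assume "h \<in> coef y"
      from coef_add[OF d this] show "(\<lambda>i. g r i - g r' i) \<in> coef y" by (simp add: d_def)
    next
      assume "(\<lambda>i. g r i - g r' i) \<in> coef y"
      from coef_diff[OF this d] show "h \<in> coef y" by (simp add: d_def)
    qed
    also have "\<dots> \<longleftrightarrow> summable (\<lambda>i. (\<phi> (z r) i - \<phi> (z r') i) *\<^sub>R x i)"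
      unfolding g_def iff by (simp add: coef_def)
    also have "\<dots> \<longleftrightarrow> summable (\<lambda>j. (\<phi> (z r) (b j) - \<phi> (z r') (b j)) *\<^sub>R x (b j))"
      by (rule summable_mono_reindex[OF b, symmetric]) (simp add: \<phi>_def z(2)[of _ r r'])
    also have "\<dots> \<longleftrightarrow> (\<lambda>j. (real (r j) - real (r' j)) / 2 ^ b j) \<in> coef (\<lambda>j. x (b j))"
      by (simp add: coef_def \<phi>_def z(1) diff_divide_distrib)
    finally show "(\<lambda>j. (real (r j) - real (r' j)) / 2 ^ b j) \<in> coef (\<lambda>j. x (b j)) \<longleftrightarrow>
        (\<lambda>i. let j = block_index p i in f j (r j) i - f j (r' j) i) \<in> coef y"
      unfolding h_def[abs_def] by (rule sym)
  qed
  then show ?thesis by (rule that)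
qed

text \<open>Otherwise there are infinitely many blocks \<open>\<sigma> n\<close> with values at distance at least \<open>1/2\<close> whose images
are less than \<open>(1/2)^n\<close> apart. Two sequences that take these values on the blocks \<open>\<sigma> n\<close> and \<open>0\<close>
elsewhere have equivalent images, but the terms of their difference do not tend to \<open>0\<close>.\<close>

lemma product_reduction_separates:
  fixes x :: "nat \<Rightarrow> 'a::banach" and y :: "nat \<Rightarrow> 'b::banach"
  assumes red: "product_reduction x y b p f" and "normalized x"
  obtains \<delta> j0 where "\<delta> > 0"
    "\<And>j t t'. j0 \<le> j \<Longrightarrow> t \<le> 2 ^ b j \<Longrightarrow> t' \<le> 2 ^ b j \<Longrightarrow> 2 ^ b j \<le> 2 * (real t - real t') \<Longrightarrow>
       \<delta> \<le> osc y (p j) (p (Suc j)) (\<lambda>i. f j t i - f j t' i)"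
proof (rule ccontr)
  assume no: "\<not> thesis"
  let ?osc = "\<lambda>j t t'. osc y (p j) (p (Suc j)) (\<lambda>i. f j t i - f j t' i)"
  have p: "strict_mono p" "p 0 = 0" and red': "\<And>r r'. (\<forall>j. r j \<le> 2 ^ b j) \<Longrightarrow> (\<forall>j. r' j \<le> 2 ^ b j) \<Longrightarrow>
        (\<lambda>j. (real (r j) - real (r' j)) / 2 ^ b j) \<in> coef (\<lambda>j. x (b j)) \<longleftrightarrow>
        (\<lambda>i. let j = block_index p i in f j (r j) i - f j (r' j) i) \<in> coef y"
    using red unfolding product_reduction_def by blast+
  have p_le: "p j \<le> p (Suc j)" for j using p(1) by (simp add: strict_mono_less_eq)
  define P where "P n = (\<lambda>(j, t, t'). t \<le> 2 ^ b j \<and> t' \<le> 2 ^ b j \<and>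
     2 ^ b j \<le> 2 * (real t - real t') \<and> ?osc j t t' < (1/2) ^ n)" for n :: nat
  have ex: "\<exists>j t t'. j0 \<le> j \<and> P n (j, t, t')" for n j0
  proof (rule ccontr)
    assume *: "\<not> (\<exists>j t t'. j0 \<le> j \<and> P n (j, t, t'))"
    have thesis
      by (rule that[of "(1/2) ^ n" j0]) (use * in \<open>auto simp: P_def not_less\<close>)
    with no show False ..
  qed
  have "\<exists>s. \<forall>n. P n (s n) \<and> fst (s n) < fst (s (Suc n))"
  proof (rule dependent_nat_choice)
    show "\<exists>s. P 0 s" using ex by blast
    show "\<exists>s'. P (Suc n) s' \<and> fst s < fst s'" for s n
      using ex[of "Suc (fst s)" "Suc n"] by fastforce
  qed
  then obtain s where s: "\<And>n. P n (s n)" "\<And>n. fst (s n) < fst (s (Suc n))" by blast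
  define \<sigma> where "\<sigma> n = fst (s n)" for n
  have \<sigma>: "strict_mono \<sigma>" using s(2) by (simp add: strict_mono_Suc_iff \<sigma>_def)
  define r where "r j = (if j \<in> range \<sigma> then fst (snd (s (inv \<sigma> j))) else 0)" for j
  define r' where "r' j = (if j \<in> range \<sigma> then snd (snd (s (inv \<sigma> j))) else 0)" for j
  have inv: "inv \<sigma> (\<sigma> n) = n" for n
    using \<sigma> by (intro inv_f_f strict_mono_imp_inj_on)
  have at_\<sigma>: "r (\<sigma> n) \<le> 2 ^ b (\<sigma> n)" "r' (\<sigma> n) \<le> 2 ^ b (\<sigma> n)"
     "2 ^ b (\<sigma> n) \<le> 2 * (real (r (\<sigma> n)) - real (r' (\<sigma> n)))"
     "?osc (\<sigma> n) (r (\<sigma> n)) (r' (\<sigma> n)) < (1/2) ^ n" for n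
  proof -
    have "P n (\<sigma> n, r (\<sigma> n), r' (\<sigma> n))"
    proof -
      have "s n = (\<sigma> n, fst (snd (s n)), snd (snd (s n)))" by (simp add: \<sigma>_def)
      moreover have "r (\<sigma> n) = fst (snd (s n))" "r' (\<sigma> n) = snd (snd (s n))"
        by (simp_all add: r_def r'_def inv)
      ultimately show ?thesis using s(1)[of n] by metis
    qed
    then show "r (\<sigma> n) \<le> 2 ^ b (\<sigma> n)" "r' (\<sigma> n) \<le> 2 ^ b (\<sigma> n)"
      "2 ^ b (\<sigma> n) \<le> 2 * (real (r (\<sigma> n)) - real (r' (\<sigma> n)))"
      "?osc (\<sigma> n) (r (\<sigma> n)) (r' (\<sigma> n)) < (1/2) ^ n"
      by (simp_all add: P_def)
  qed
  have r: "\<forall>j. r j \<le> 2 ^ b j" "\<forall>j. r' j \<le> 2 ^ b j"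
    using at_\<sigma>(1,2) by (auto simp: r_def r'_def)
  define h where "h i = (let j = block_index p i in f j (r j) i - f j (r' j) i)" for i
  have osc_h: "osc y (p j) (p (Suc j)) h = ?osc j (r j) (r' j)" for j
    using block_index_eq[OF p(1)] by (intro osc_cong) (simp add: h_def Let_def)
  have "summable (\<lambda>n. osc y (p (\<sigma> n)) (p (Suc (\<sigma> n))) h)"
  proof (rule summable_comparison_test')
    show "summable (\<lambda>n. (1/2::real) ^ n)" by (simp add: summable_geometric)
    show "norm (osc y (p (\<sigma> n)) (p (Suc (\<sigma> n))) h) \<le> (1/2) ^ n" if "0 \<le> n" for n
      using at_\<sigma>(4)[of n] osc_nonneg[OF p_le, of y "\<sigma> n" h] osc_h[of "\<sigma> n"] by simp
  qed
  moreover have "osc y (p j) (p (Suc j)) h = 0" if "j \<notin> range \<sigma>" for j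
  proof -
    have "r j = r' j" using that by (simp add: r_def r'_def)
    moreover have "osc y (p j) (p (Suc j)) (\<lambda>i. 0) = 0"
      using osc_leI[OF p_le, of j "\<lambda>i. 0" y 0] osc_nonneg[OF p_le, of y j "\<lambda>i. 0"] by simp
    ultimately show ?thesis unfolding osc_h by simp
  qed
  ultimately have "summable (\<lambda>j. osc y (p j) (p (Suc j)) h)"
    using summable_mono_reindex[OF \<sigma>, of "\<lambda>j. osc y (p j) (p (Suc j)) h"] by simp
  then have "h \<in> coef y" by (rule coef_if_summable_osc[OF p order_refl])
  then have "(\<lambda>j. (real (r j) - real (r' j)) / 2 ^ b j) \<in> coef (\<lambda>j. x (b j))"
    using red'[OF r] unfolding h_def by simp
  then have "(\<lambda>j. ((real (r j) - real (r' j)) / 2 ^ b j) *\<^sub>R x (b j)) \<longlonglongrightarrow> 0"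
    unfolding coef_def by (intro summable_LIMSEQ_zero) simp
  then have "(\<lambda>j. norm (((real (r j) - real (r' j)) / 2 ^ b j) *\<^sub>R x (b j))) \<longlonglongrightarrow> 0"
    by (rule tendsto_norm_zero)
  then have "(\<lambda>j. \<bar>(real (r j) - real (r' j)) / 2 ^ b j\<bar>) \<longlonglongrightarrow> 0"
    using \<open>normalized x\<close> by (simp add: normalized_def)
  from LIMSEQ_subseq_LIMSEQ[OF this \<sigma>]
  have "(\<lambda>n. \<bar>(real (r (\<sigma> n)) - real (r' (\<sigma> n))) / 2 ^ b (\<sigma> n)\<bar>) \<longlonglongrightarrow> 0"
    by (simp add: o_def)
  moreover have "1/2 \<le> \<bar>(real (r (\<sigma> n)) - real (r' (\<sigma> n))) / 2 ^ b (\<sigma> n)\<bar>" for n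
  proof -
    have "1/2 \<le> (real (r (\<sigma> n)) - real (r' (\<sigma> n))) / 2 ^ b (\<sigma> n)"
      using at_\<sigma>(3)[of n] by (simp add: field_simps)
    then show ?thesis by linarith
  qed
  ultimately show False using LIMSEQ_le_const[of _ 0 "1/2::real"] by fastforce
qed

section \<open>The contradiction\<close>

theorem theorem1p2:
  fixes x :: "nat \<Rightarrow> 'a::banach" and y :: "nat \<Rightarrow> 'b::banach"
  assumes "basic_sequence x" and "normalized x"
    and "basic_sequence y" and "normalized y"
    and "\<And>b::nat \<Rightarrow> nat. strict_mono b \<Longrightarrow> \<not> dominates (\<lambda>n. x (b n)) y"
    and "lower_semi_homogeneous y"
  shows "\<not> borel_reducible (coef_rel x) (coef_rel y)"
proof
  assume "borel_reducible (coef_rel x) (coef_rel y)"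
  then obtain b p f where red: "product_reduction x y b p f"
    by (rule borel_reducible_imp_product_reduction)
  then have b: "strict_mono b" and p: "strict_mono p" "p 0 = 0"
    unfolding product_reduction_def by blast+
  have p_le: "p j \<le> p (Suc j)" for j using p(1) by (simp add: strict_mono_less_eq)
  obtain \<delta> j0 where "\<delta> > 0" and
    sep: "\<And>j t t'. j0 \<le> j \<Longrightarrow> t \<le> 2 ^ b j \<Longrightarrow> t' \<le> 2 ^ b j \<Longrightarrow> 2 ^ b j \<le> 2 * (real t - real t') \<Longrightarrow>
       \<delta> \<le> osc y (p j) (p (Suc j)) (\<lambda>i. f j t i - f j t' i)"
    using product_reduction_separates[OF red assms(2)] by blast
  obtain a where a: "a \<in> coef (\<lambda>j. x (b j))" "a \<notin> coef y"
    using assms(5)[OF b] unfolding dominates_def by blast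
  have xb: "normalized (\<lambda>j. x (b j))" using assms(2) by (simp add: normalized_def)
  obtain j1 where j1: "\<And>j. j1 \<le> j \<Longrightarrow> \<bar>a j\<bar> \<le> 1/2"
  proof -
    have "(\<lambda>j. norm (a j *\<^sub>R x (b j))) \<longlonglongrightarrow> 0"
      using a(1) unfolding coef_def by (intro tendsto_norm_zero summable_LIMSEQ_zero) simp
    then have "(\<lambda>j. \<bar>a j\<bar>) \<longlonglongrightarrow> 0" using xb by (simp add: normalized_def)
    then have "eventually (\<lambda>j. \<bar>a j\<bar> < 1/2) sequentially" by (rule order_tendstoD) simp
    then show ?thesis using that unfolding eventually_sequentially by (meson less_imp_le)
  qed
  define J where "J = max j0 j1"
  \<comment> \<open>\<open>k j / 2 ^ b j\<close> is \<open>\<bar>a j\<bar>\<close> rounded down to the grid. The finitely many \<open>j < J\<close>, where the blocks need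
    not separate or \<open>a j\<close> may exceed \<open>1/2\<close>, are given the value \<open>0\<close>.\<close>
  define k where "k j = (if J \<le> j then nat \<lfloor>\<bar>a j\<bar> * 2 ^ b j\<rfloor> else 0)" for j
  have k: "\<bar>real (k j) - \<bar>a j\<bar> * 2 ^ b j\<bar> \<le> 1" "2 * k j \<le> 2 ^ b j" if "J \<le> j" for j
  proof -
    have eq: "real (k j) = of_int \<lfloor>\<bar>a j\<bar> * 2 ^ b j\<rfloor>" using that by (simp add: k_def)
    show "\<bar>real (k j) - \<bar>a j\<bar> * 2 ^ b j\<bar> \<le> 1" unfolding eq by linarith
    have "2 * (\<bar>a j\<bar> * 2 ^ b j) \<le> 2 ^ b j" using j1[of j] that by (simp add: J_def)
    then have "2 * real (k j) \<le> 2 ^ b j" unfolding eq by linarith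
    then have "real (2 * k j) \<le> real (2 ^ b j)" by simp
    then show "2 * k j \<le> 2 ^ b j" unfolding of_nat_le_iff .
  qed
  have "\<exists>t. t + k j \<le> 2 ^ b j \<and> \<delta> * (real (k j) / 2 ^ b j)
      \<le> osc y (p j) (p (Suc j)) (\<lambda>i. f j (t + k j) i - f j t i)" for j
  proof (cases "J \<le> j")
    case True
    have "\<delta> \<le> osc y (p j) (p (Suc j)) (\<lambda>i. f j t i - f j 0 i)" if "t \<le> 2 ^ b j" "2 ^ b j \<le> 2 * t" for t
    proof (rule sep)
      have "real (2 ^ b j) \<le> real (2 * t)" using that(2) by (rule of_nat_mono)
      then show "2 ^ b j \<le> 2 * (real t - real 0)" by simp
    qed (use True that in \<open>auto simp: J_def\<close>)
    then obtain t where "t + k j \<le> 2 ^ b j" "\<delta> * (real (k j) / real (2 ^ b j))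
      \<le> osc y (p j) (p (Suc j)) (\<lambda>i. f j (t + k j) i - f j t i)"
      using exists_long_step[OF p_le _ k(2)[OF True], of \<delta> y j "f j"] \<open>\<delta> > 0\<close> by auto
    then show ?thesis by auto
  next
    case False
    then show ?thesis using osc_nonneg[OF p_le, of y j "\<lambda>i. 0"] by (intro exI[of _ 0]) (simp add: k_def)
  qed
  then obtain t where t: "\<And>j. t j + k j \<le> 2 ^ b j"
    "\<And>j. \<delta> * (real (k j) / 2 ^ b j) \<le> osc y (p j) (p (Suc j)) (\<lambda>i. f j (t j + k j) i - f j (t j) i)"
    by metis
  \<comment> \<open>the endpoints of a long step, ordered so that their difference has the sign of \<open>a j\<close>\<close>
  define r where "r j = (if 0 \<le> a j then t j + k j else t j)" for j
  define r' where "r' j = (if 0 \<le> a j then t j else t j + k j)" for j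
  define a' where "a' j = (real (r j) - real (r' j)) / 2 ^ b j" for j
  have a'_eq: "a' j = (if 0 \<le> a j then 1 else -1) * (real (k j) / 2 ^ b j)" for j
    by (simp add: a'_def r_def r'_def)
  have "norm \<bar>a' j - a j\<bar> \<le> (1/2) ^ j" if "J \<le> j" for j
  proof -
    have "a' j - a j = (if 0 \<le> a j then 1 else -1) * (real (k j) - \<bar>a j\<bar> * 2 ^ b j) / 2 ^ b j"
      by (simp add: a'_eq field_simps)
    then have "\<bar>a' j - a j\<bar> \<le> 1 / 2 ^ b j"
      using k(1)[OF that] by (simp add: abs_mult divide_right_mono)
    also have "\<dots> \<le> 1 / 2 ^ j"
      using strict_mono_imp_increasing[OF b, of j] by (intro divide_left_mono power_increasing) auto
    finally show ?thesis by (simp add: power_one_over)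
  qed
  note bound = this
  have "summable (\<lambda>j. \<bar>a' j - a j\<bar>)"
    by (rule summable_comparison_test'[of "\<lambda>j. (1/2::real) ^ j", OF _ bound])
       (rule summable_geometric, simp)
  note close = coef_absolutely_summable[OF xb this] coef_absolutely_summable[OF assms(4) this]
  have "a' \<in> coef (\<lambda>j. x (b j))" using coef_add[OF a(1) close(1)] by simp
  moreover have "\<forall>j. r j \<le> 2 ^ b j" "\<forall>j. r' j \<le> 2 ^ b j"
    using t(1) by (auto simp: r_def r'_def intro: order_trans[OF le_add1])
  moreover define h where "h i = (let j = block_index p i in f j (r j) i - f j (r' j) i)" for i
  ultimately have h: "h \<in> coef y"
    using red unfolding product_reduction_def a'_def[abs_def] h_def[abs_def] by blast
  have osc_h: "\<delta> * \<bar>a' j\<bar> \<le> osc y (p j) (p (Suc j)) h" for j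
  proof -
    have "osc y (p j) (p (Suc j)) h = osc y (p j) (p (Suc j)) (\<lambda>i. f j (r j) i - f j (r' j) i)"
      using block_index_eq[OF p(1)] by (intro osc_cong) (simp add: h_def Let_def)
    also have "\<dots> = osc y (p j) (p (Suc j)) (\<lambda>i. f j (t j + k j) i - f j (t j) i)"
      by (simp add: r_def r'_def osc_minus_commute[of y _ _ "f j (t j)"])
    finally show ?thesis using t(2)[of j] by (simp add: a'_eq abs_mult)
  qed
  have "\<exists>m n. p j \<le> m \<and> m \<le> n \<and> n \<le> p (Suc j) \<and>
      osc y (p j) (p (Suc j)) h = norm (\<Sum>i=m..<n. h i *\<^sub>R y i)" for j
    using osc_attained[OF p_le, of j y h] by metis
  then obtain m n where mn: "\<And>j. p j \<le> m j" "\<And>j. m j \<le> n j" "\<And>j. n j \<le> p (Suc j)"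
    "\<And>j. osc y (p j) (p (Suc j)) h = norm (\<Sum>i=m j..<n j. h i *\<^sub>R y i)"
    by metis
  \<comment> \<open>Only the subintervals on which the oscillation is attained are kept, so that the block norms of
    \<open>h'\<close> are the oscillations of \<open>h\<close>; solidity of \<open>coef y\<close> allows this.\<close>
  define h' where "h' i = (let j = block_index p i in if m j \<le> i \<and> i < n j then h i else 0)" for i
  have "h' \<in> coef y"
    by (rule coef_solid[OF assms(4,6) h, where C=1]) (simp add: h'_def Let_def)
  from block_norms_in_coef[OF assms(4,6) p this]
  have "(\<lambda>j. norm (\<Sum>i=p j..<p (Suc j). h' i *\<^sub>R y i)) \<in> coef y" .
  moreover have "(\<Sum>i=p j..<p (Suc j). h' i *\<^sub>R y i) = (\<Sum>i=m j..<n j. h i *\<^sub>R y i)" for j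
  proof (rule sum.mono_neutral_cong_right)
    show "{m j..<n j} \<subseteq> {p j..<p (Suc j)}" using mn(1,3)[of j] by auto
    have idx: "block_index p i = j" if "i \<in> {p j..<p (Suc j)}" for i
      using that by (intro block_index_eq[OF p(1)]) auto
    show "\<forall>i\<in>{p j..<p (Suc j)} - {m j..<n j}. h' i *\<^sub>R y i = 0"
      using idx by (auto simp: h'_def Let_def)
    show "h' i *\<^sub>R y i = h i *\<^sub>R y i" if "i \<in> {m j..<n j}" for i
      using idx[of i] that mn(1,3)[of j] by (auto simp: h'_def Let_def)
  qed simp
  ultimately have "(\<lambda>j. osc y (p j) (p (Suc j)) h) \<in> coef y" by (simp add: mn(4))
  then have "a' \<in> coef y"
  proof (rule coef_solid[OF assms(4,6), where C="1/\<delta>"])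
    fix j
    show "\<bar>a' j\<bar> \<le> 1/\<delta> * \<bar>osc y (p j) (p (Suc j)) h\<bar>"
      using osc_h[of j] \<open>\<delta> > 0\<close> osc_nonneg[OF p_le, of y j h] by (simp add: field_simps)
  qed
  from coef_diff[OF this close(2)] have "a \<in> coef y" by simp
  with a(2) show False ..
qed

end
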